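(* There is an algorithm that, given a string $S$ of length $n$, computes a maximal square subsequence of $S$ in $O(n\log n)$ time.
   Context: A square subsequence of $S$ is a subsequence of $S$ of the form $XX$ for some string $X$. A square subsequence $B$ of $S$ is maximal if no other square subsequence of $S$ properly contains $B$ as a subsequence. *)

theory Defs
  imports
    "HOL-Library.Sublist"
    "HOL-Library.Landau_Symbols"
    "HOL-Analysis.Analysis"
begin

section \<open>Maximal square subsequences\<close>

text \<open>
  The string \<open>X\<close> in \<open>XX\<close> may be empty, so the empty string is a square subsequence of every
  string. A string without repeated letters has no other one.
\<close>

definition square_subseq :: "'a list \<Rightarrow> 'a list \<Rightarrow> bool" where
  "square_subseq B S \<longleftrightarrow> (\<exists>X. B = X @ X) \<and> subseq B S"

definition maximal_square_subseq :: "'a list \<Rightarrow> 'a list \<Rightarrow> bool" where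
  "maximal_square_subseq B S \<longleftrightarrow>
     square_subseq B S \<and> (\<nexists>B'. square_subseq B' S \<and> strict_subseq B B')"


section \<open>A word RAM\<close>

text \<open>
  Algorithms are programs of a structured language for a word RAM. A program uses finitely many
  named registers and finitely many named arrays. Every array has \<open>2 ^ w\<close> cells, and every
  register and every cell holds a \<open>w\<close>-bit word, that is, a natural number below \<open>2 ^ w\<close>.
  The word length \<open>w\<close> is a parameter of the semantics and not of the program: one and the same
  program has to work for all inputs and all admissible word lengths.
\<close>

datatype binop = Add | Sub | Mul | Div | Mod

datatype expr =
    Const nat
  | Reg string
  | Load string expr
  | Op binop expr expr

datatype cond = Less expr expr | Equal expr expr | Neg cond | Conj cond cond

datatype com =
    Skip
  | Assign string expr
  | Store string expr expr
  | Seq com com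
  | Ite cond com com
  | While cond com

record state =
  reg :: "string \<Rightarrow> nat"
  arr :: "string \<Rightarrow> nat \<Rightarrow> nat"

text \<open>
  Addition and multiplication wrap around modulo \<open>2 ^ w\<close>. Subtraction is truncated at \<open>0\<close>.
  Division and remainder are those of \<open>nat\<close>, with \<open>a div 0 = 0\<close> and \<open>a mod 0 = a\<close>. None of the
  last three leaves the range of words.
\<close>

fun binop_val :: "nat \<Rightarrow> binop \<Rightarrow> nat \<Rightarrow> nat \<Rightarrow> nat" where
  "binop_val w Add a b = (a + b) mod 2 ^ w"
| "binop_val w Sub a b = a - b"
| "binop_val w Mul a b = (a * b) mod 2 ^ w"
| "binop_val w Div a b = a div b"
| "binop_val w Mod a b = a mod b"

fun expr_val :: "nat \<Rightarrow> expr \<Rightarrow> state \<Rightarrow> nat" where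
  "expr_val w (Const k) s = k mod 2 ^ w"
| "expr_val w (Reg x) s = reg s x"
| "expr_val w (Load a e) s = arr s a (expr_val w e s)"
| "expr_val w (Op f e1 e2) s = binop_val w f (expr_val w e1 s) (expr_val w e2 s)"

fun cond_val :: "nat \<Rightarrow> cond \<Rightarrow> state \<Rightarrow> bool" where
  "cond_val w (Less e1 e2) s \<longleftrightarrow> expr_val w e1 s < expr_val w e2 s"
| "cond_val w (Equal e1 e2) s \<longleftrightarrow> expr_val w e1 s = expr_val w e2 s"
| "cond_val w (Neg b) s \<longleftrightarrow> \<not> cond_val w b s"
| "cond_val w (Conj b1 b2) s \<longleftrightarrow> cond_val w b1 s \<and> cond_val w b2 s"

text \<open>
  Every constant, register access, array access, word operation, comparison and Boolean connective
  takes one unit of time.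
\<close>

fun expr_cost :: "expr \<Rightarrow> nat" where
  "expr_cost (Const k) = 1"
| "expr_cost (Reg x) = 1"
| "expr_cost (Load a e) = expr_cost e + 1"
| "expr_cost (Op f e1 e2) = expr_cost e1 + expr_cost e2 + 1"

fun cond_cost :: "cond \<Rightarrow> nat" where
  "cond_cost (Less e1 e2) = expr_cost e1 + expr_cost e2 + 1"
| "cond_cost (Equal e1 e2) = expr_cost e1 + expr_cost e2 + 1"
| "cond_cost (Neg b) = cond_cost b + 1"
| "cond_cost (Conj b1 b2) = cond_cost b1 + cond_cost b2 + 1"

text \<open>
  \<open>exec w c s t s'\<close>: with word length \<open>w\<close>, the program \<open>c\<close> started in \<open>s\<close> terminates after
  exactly \<open>t\<close> time units in \<open>s'\<close>.
\<close>

inductive exec :: "nat \<Rightarrow> com \<Rightarrow> state \<Rightarrow> nat \<Rightarrow> state \<Rightarrow> bool" for w :: nat where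
  Skip: "exec w Skip s 1 s"
| Assign: "exec w (Assign x e) s (expr_cost e + 1) (s\<lparr>reg := (reg s)(x := expr_val w e s)\<rparr>)"
| Store: "exec w (Store a i e) s (expr_cost i + expr_cost e + 1)
    (s\<lparr>arr := (arr s)(a := (arr s a)(expr_val w i s := expr_val w e s))\<rparr>)"
| Seq: "exec w c1 s t1 s' \<Longrightarrow> exec w c2 s' t2 s'' \<Longrightarrow> exec w (Seq c1 c2) s (t1 + t2) s''"
| IteTrue: "cond_val w b s \<Longrightarrow> exec w c1 s t s' \<Longrightarrow> exec w (Ite b c1 c2) s (cond_cost b + t + 1) s'"
| IteFalse: "\<not> cond_val w b s \<Longrightarrow> exec w c2 s t s' \<Longrightarrow> exec w (Ite b c1 c2) s (cond_cost b + t + 1) s'"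
| WhileFalse: "\<not> cond_val w b s \<Longrightarrow> exec w (While b c) s (cond_cost b + 1) s"
| WhileTrue: "cond_val w b s \<Longrightarrow> exec w c s t1 s' \<Longrightarrow> exec w (While b c) s' t2 s'' \<Longrightarrow>
    exec w (While b c) s (cond_cost b + t1 + t2 + 1) s''"

inductive_cases exec_elims:
  "exec w Skip s t s'" "exec w (Assign x e) s t s'" "exec w (Store a i e) s t s'"
  "exec w (Seq c1 c2) s t s'" "exec w (Ite b c1 c2) s t s'" "exec w (While b c) s t s'"

lemma exec_deterministic:
  assumes "exec w c s t s'" and "exec w c s u s''"
  shows "t = u \<and> s' = s''"
  using assms
proof (induction arbitrary: u s'' rule: exec.induct)
  case (WhileTrue b s c t1 s' t2 s1)
  from WhileTrue.prems show ?case
    by (rule exec_elims(6)) (use WhileTrue.hyps(1) WhileTrue.IH in \<open>blast, metis add_Suc_right Suc_eq_plus1\<close>)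
qed (erule exec_elims; fastforce)+

definition words :: "nat \<Rightarrow> state \<Rightarrow> bool" where
  "words w s \<longleftrightarrow> (\<forall>x. reg s x < 2 ^ w) \<and> (\<forall>a i. arr s a i < 2 ^ w)"

lemma expr_val_word: "words w s \<Longrightarrow> expr_val w e s < 2 ^ w"
proof (induction e)
  case (Op f e1 e2)
  then show ?case
    by (cases f) (auto simp: less_imp_diff_less intro: le_less_trans[OF div_le_dividend]
        le_less_trans[OF mod_less_eq_dividend])
qed (auto simp: words_def)

lemma exec_words: "exec w c s t s' \<Longrightarrow> words w s \<Longrightarrow> words w s'"
  by (induction rule: exec.induct) (auto simp: expr_val_word words_def[of w "_\<lparr>reg := _\<rparr>"]
      words_def[of w "_\<lparr>arr := _\<rparr>"] dest: words_def[THEN iffD1])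

text \<open>
  The input string is in the cells \<open>0, \<dots>, n - 1\<close> of array \<open>S\<close> and its length in register \<open>n\<close>;
  everything else is \<open>0\<close>. The output string is expected in array \<open>B\<close>, its length in register \<open>m\<close>.
\<close>

definition input_state :: "nat list \<Rightarrow> state" where
  "input_state S =
     \<lparr>reg = (\<lambda>_. 0)(''n'' := length S),
      arr = (\<lambda>_ _. 0)(''S'' := (\<lambda>i. if i < length S then S ! i else 0))\<rparr>"

definition output_string :: "state \<Rightarrow> nat list" where
  "output_string s = map (arr s ''B'') [0..<reg s ''m'']"

text \<open>
  Letters are words. The first condition says that the word length is at least
  \<open>k\<close> times the binary logarithm of \<open>n + 2\<close>, where \<open>n\<close> is the length of the input and \<open>k\<close> is
  a constant: the usual assumption that words have at least a constant multiple of \<open>log n\<close> bits.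
  The alphabet is bounded only by the word length.
\<close>

definition admissible :: "nat \<Rightarrow> nat \<Rightarrow> nat list \<Rightarrow> bool" where
  "admissible k w S \<longleftrightarrow> (length S + 2) ^ k \<le> 2 ^ w \<and> (\<forall>x \<in> set S. x < 2 ^ w)"

text \<open>
  The program \<open>P\<close> terminates within time \<open>T n\<close> on every string of length \<open>n\<close>, with an output that
  stands in relation \<open>R\<close> to the input.
\<close>

definition computes_in_time :: "com \<Rightarrow> (nat list \<Rightarrow> nat list \<Rightarrow> bool) \<Rightarrow> (nat \<Rightarrow> real) \<Rightarrow> bool" where
  "computes_in_time P R T \<longleftrightarrow>
     (\<exists>k. \<forall>w S. admissible k w S \<longrightarrow>
        (\<exists>t s. exec w P (input_state S) t s \<and> real t \<le> T (length S) \<and> R (output_string s) S))"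

end

theory Submission
  imports Defs "HOL-Library.Log_Nat" "HOL-Real_Asymp.Real_Asymp"
begin

text \<open>
  Since \<open>XX\<close> is a subsequence of \<open>YY\<close> iff \<open>X\<close> is one of \<open>Y\<close>, we need a maximal \<open>X\<close> with \<open>XX\<close> in \<open>S\<close>.
  For a fixed cut of \<open>S\<close> this is a maximal common subsequence of the two parts, and the difficulty is
  that \<open>X\<close> may be extensible at another cut. Let \<open>c\<close> be the letter whose last occurrence \<open>e\<close> is the latest
  among all repeated letters, let \<open>p\<^sub>0 < p\<^sub>1 < \<dots>\<close> be its occurrences, let \<open>m\<close> be half their number,
  rounded down, and start with \<open>c ^ m\<close>. Squares above it skip at most one occurrence of \<open>c\<close>. First
  append a maximal common subsequence \<open>V\<close> of the parts strictly between \<open>p\<^bsub>m-1\<^esub>\<close> and \<open>p\<^sub>m\<close> and after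
  \<open>p\<^bsub>2m-1\<^esub>\<close>. Then the first half of any larger square ends where the leftmost embedding of \<open>c ^ m V\<close>
  ends, or at \<open>p\<^sub>m\<close>. It therefore suffices to extend to a maximal common subsequence at these two cuts,
  one after the other, the second one only if it is feasible.

  A common subsequence is extended gap by gap from left to right. If the windows of a gap have no letter
  in common, then moving past the next letter skips one of the windows entirely. This pays for scanning both
  windows alternately, so there are linearly many steps, each with a few binary searches.
\<close>

section \<open>Subsequences and segments\<close>

text \<open>Taking the letter \<open>c\<close> that is repeated last serves two ends. Every letter
  after \<open>e\<close> is new and occurs there only once, so no square uses it, and
  \<open>e\<close> bounds all squares on the right. Moreover, as \<open>c\<close> stands at this
  boundary, a square that is cut after \<open>p_m\<close> needs every remaining \<open>c\<close> for
  its second half: that half ends at \<open>e\<close> with the letter \<open>c\<close>, nothing can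
  follow, and the first half can be pulled back to end at \<open>p_m\<close>. A cut between
  \<open>p_(m-1)\<close> and \<open>p_m\<close> leaves freedom only behind the last \<open>c\<close>
  of each half, and this is what fixing a maximal \<open>V\<close> removes. The two refinements are
  compatible because a word that is infeasible at a cut has only infeasible supersequences there.

  A table of next occurrences for all positions and letters could be quadratically large. Each
  letter therefore gets a sorted list of its occurrences, and bisecting these lists is the only
  source of the logarithm.\<close>

lemma strict_subseq_insertion:
  assumes "subseq X Z" "X \<noteq> Z"
  obtains X1 c X2 where "X = X1 @ X2" "subseq (X1 @ c # X2) Z"
proof -
  \<comment> \<open>The inserted letter is the first letter of \<open>Z\<close> that the embedding
    skips. Hence maximality only has to be checked against one-letter insertions.\<close>
  have "\<exists>X1 c X2. X = X1 @ X2 \<and> subseq (X1 @ c # X2) Z"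
    using assms
  proof (induction rule: list_emb.induct)
    case (list_emb_Nil ys)
    then show ?case by (cases ys) auto
  next
    case (list_emb_Cons xs ys y)
    have "subseq ([] @ y # xs) (y # ys)"
      using list_emb_Cons.hyps by simp
    then show ?case by (metis append_Nil)
  next
    case (list_emb_Cons2 x y xs ys)
    then obtain X1 c X2 where "xs = X1 @ X2" "subseq (X1 @ c # X2) ys" by auto
    then have "x # xs = (x # X1) @ X2 \<and> subseq ((x # X1) @ c # X2) (y # ys)"
      using list_emb_Cons2.hyps by simp
    then show ?case by blast
  qed
  then show thesis using that by blast
qed

text \<open>Cut the embedding of \<open>X @ X\<close> where the first \<open>Y\<close> ends. If the
  first \<open>X\<close> is not complete there, then the second \<open>X\<close> lies entirely in
  the second \<open>Y\<close>.\<close>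

lemma subseq_square_iff: "subseq (X @ X) (Y @ Y) \<longleftrightarrow> subseq X Y"
proof
  assume "subseq (X @ X) (Y @ Y)"
  then obtain A B where AB: "X @ X = A @ B" "subseq A Y" "subseq B Y"
    by (rule subseq_appendE)
  from AB(1) obtain us where "X = A @ us \<and> us @ X = B \<or> X @ us = A \<and> X = us @ B"
    by (auto simp: append_eq_append_conv2)
  then have "subseq X A \<or> subseq X B" using subseq_drop_many[of X X us] by fastforce
  then show "subseq X Y" using AB by (meson subseq_order.order_trans)
qed (rule list_emb_append_mono)

lemma subseq_setD: "subseq xs ys \<Longrightarrow> set xs \<subseteq> set ys"
  by (induction rule: list_emb.induct) auto

lemma subseq_Cons_notin: "x \<notin> set xs \<Longrightarrow> subseq (x # Y) (xs @ x # zs) \<longleftrightarrow> subseq Y zs"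
  by (induction xs) (simp_all del: list_emb_append2)

lemma subseq_snoc_notin:
  assumes "x \<notin> set zs"
  shows "subseq (Y @ [x]) (xs @ x # zs) \<longleftrightarrow> subseq Y xs"
proof
  assume "subseq (Y @ [x]) (xs @ x # zs)"
  then have "subseq (Y @ [x]) ((xs @ [x]) @ zs)" by simp
  then obtain A B where AB: "Y @ [x] = A @ B" "subseq A (xs @ [x])" "subseq B zs"
    by (rule subseq_appendE)
  have "B = []"
  proof (rule ccontr)
    assume "B \<noteq> []"
    then have "x \<in> set B" using AB(1) by (metis last_appendR last_in_set last_snoc)
    then show False using subseq_setD[OF AB(3)] assms by blast
  qed
  then have "subseq (Y @ [x]) (xs @ [x])" using AB(1,2) by simp
  then show "subseq Y xs" by (simp only: subseq_append)
next
  assume "subseq Y xs"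
  then have "subseq (Y @ [x]) ((xs @ [x]) @ zs)"
    by (intro subseq_rev_drop_many list_emb_append_mono) simp_all
  then show "subseq (Y @ [x]) (xs @ x # zs)" by simp
qed

lemma subseq_snoc_rev:
  assumes "subseq (Y @ [x]) (xs @ zs)" "x \<notin> set zs"
  shows "subseq (Y @ [x]) xs"
proof -
  obtain A B where AB: "Y @ [x] = A @ B" "subseq A xs" "subseq B zs"
    using assms(1) by (rule subseq_appendE)
  have "B = []"
  proof (rule ccontr)
    assume "B \<noteq> []"
    then have "x \<in> set B" using AB(1) by (metis last_appendR last_in_set last_snoc)
    then show False using subseq_setD[OF AB(3)] assms by blast
  qed
  then show ?thesis using AB(1,2) by simp
qed

lemma subseq_count_list: "subseq xs ys \<Longrightarrow> count_list xs x \<le> count_list ys x"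
  by (induction rule: list_emb.induct) auto

lemma count_list_replicate: "count_list (replicate n x) y = (if x = y then n else 0)"
  by (induction n) auto

lemma subseq_replicate_iff: "subseq (replicate n x) ys \<longleftrightarrow> n \<le> count_list ys x"
proof
  assume "subseq (replicate n x) ys"
  then show "n \<le> count_list ys x"
    by (metis subseq_count_list count_list_replicate)
next
  show "n \<le> count_list ys x \<Longrightarrow> subseq (replicate n x) ys"
  proof (induction ys arbitrary: n)
    case (Cons y ys)
    then show ?case
      using Cons.IH[of n] Cons.IH[of "n - 1"] by (cases n) (auto split: if_splits)
  qed simp
qed

section \<open>Segments of a sequence and cuts of an embedding\<close>

definition seg :: "(nat \<Rightarrow> 'a) \<Rightarrow> nat \<Rightarrow> nat \<Rightarrow> 'a list" where
  "seg f i j = map f [i..<j]"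

lemma length_seg [simp]: "length (seg f i j) = j - i"
  by (simp add: seg_def)

lemma set_seg: "set (seg f i j) = f ` {i..<j}"
  by (simp add: seg_def)

lemma in_set_seg: "x \<in> set (seg f i j) \<longleftrightarrow> (\<exists>k. i \<le> k \<and> k < j \<and> f k = x)"
  by (auto simp: set_seg)

lemma seg_empty [simp]: "j \<le> i \<Longrightarrow> seg f i j = []"
  by (simp add: seg_def)

lemma seg_split: "i \<le> j \<Longrightarrow> j \<le> k \<Longrightarrow> seg f i k = seg f i j @ seg f j k"
  unfolding seg_def by (metis map_append le_add_diff_inverse upt_add_eq_append)

lemma seg_Cons: "i < k \<Longrightarrow> seg f i k = f i # seg f (Suc i) k"
  by (simp add: seg_def upt_conv_Cons)

lemma seg_snoc: "i \<le> k \<Longrightarrow> seg f i (Suc k) = seg f i k @ [f k]"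
  by (simp add: seg_def)

lemma seg_split_at: "i \<le> p \<Longrightarrow> p < k \<Longrightarrow> seg f i k = seg f i p @ f p # seg f (Suc p) k"
  using seg_split[of i p k f] seg_Cons[of p k f] by simp

lemma seg_cong: "(\<And>i. l \<le> i \<Longrightarrow> i < h \<Longrightarrow> f i = g i) \<Longrightarrow> seg f l h = seg g l h"
  by (simp add: seg_def)

lemma subseq_seg_mono:
  assumes "i' \<le> i" "k \<le> k'"
  shows "subseq (seg f i k) (seg f i' k')"
proof (cases "i \<le> k")
  case True
  then have "seg f i' k' = seg f i' i @ seg f i k @ seg f k k'"
    using assms seg_split[of i' i k' f] seg_split[of i k k' f] by simp
  moreover have "subseq (seg f i k) (seg f i' i @ seg f i k @ seg f k k')"
    by (intro subseq_drop_many subseq_rev_drop_many) simp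
  ultimately show ?thesis by argo
qed simp

lemma subseq_segI: "subseq X (seg f i k) \<Longrightarrow> i' \<le> i \<Longrightarrow> k \<le> k' \<Longrightarrow> subseq X (seg f i' k')"
  using subseq_seg_mono subseq_order.order_trans by blast

lemma subseq_append_segI:
  "subseq X (seg f i j) \<Longrightarrow> subseq Y (seg f j k) \<Longrightarrow> i \<le> j \<Longrightarrow> j \<le> k \<Longrightarrow> subseq (X @ Y) (seg f i k)"
  using seg_split[of i j k f] by (simp add: list_emb_append_mono)

lemma subseq_append_segE:
  assumes "subseq (X @ Y) (seg f i k)" "i \<le> k"
  obtains j where "i \<le> j" "j \<le> k" "subseq X (seg f i j)" "subseq Y (seg f j k)"
proof -
  obtain us vs where uv: "seg f i k = us @ vs" "subseq X us" "subseq Y vs"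
    using list_emb_appendD[OF assms(1)] by blast
  let ?j = "i + length us"
  have le: "?j \<le> k" using arg_cong[OF uv(1), of length] assms(2) by simp
  then have "us @ vs = seg f i ?j @ seg f ?j k"
    using uv(1) seg_split[of i ?j k f] by simp
  then have "us = seg f i ?j \<and> vs = seg f ?j k"
    by (subst (asm) append_eq_append_conv) simp_all
  then show thesis using that[of ?j] uv le by auto
qed

text \<open>
  The positions \<open>a\<close> and \<open>q\<close> of the leftmost embedding of \<open>U\<close> and of the rightmost embedding of \<open>V\<close> are
  characterised by what still fits after, respectively before, them.
\<close>

definition Lres :: "(nat \<Rightarrow> 'a) \<Rightarrow> nat \<Rightarrow> nat \<Rightarrow> 'a list \<Rightarrow> nat \<Rightarrow> bool" where
  "Lres f l h U a \<longleftrightarrow> l \<le> a \<and> a \<le> h \<and>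
     (\<forall>Y. subseq (U @ Y) (seg f l h) \<longleftrightarrow> subseq Y (seg f a h))"

definition Rres :: "(nat \<Rightarrow> 'a) \<Rightarrow> nat \<Rightarrow> nat \<Rightarrow> 'a list \<Rightarrow> nat \<Rightarrow> bool" where
  "Rres f l h V q \<longleftrightarrow> l \<le> q \<and> q \<le> h \<and>
     (\<forall>i Y. l \<le> i \<and> i \<le> h \<longrightarrow> (subseq (Y @ V) (seg f i h) \<longleftrightarrow> i \<le> q \<and> subseq Y (seg f i q)))"

lemma Lres_iff: "Lres f l h U a \<Longrightarrow> subseq (U @ Y) (seg f l h) \<longleftrightarrow> subseq Y (seg f a h)"
  by (simp add: Lres_def)

lemma Rres_iff:
  "Rres f l h V q \<Longrightarrow> l \<le> i \<Longrightarrow> i \<le> h \<Longrightarrow>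
    subseq (Y @ V) (seg f i h) \<longleftrightarrow> i \<le> q \<and> subseq Y (seg f i q)"
  by (simp add: Rres_def)

lemma Lres_Nil: "l \<le> h \<Longrightarrow> Lres f l h [] l"
  by (simp add: Lres_def)

lemma Rres_Nil: "l \<le> h \<Longrightarrow> Rres f l h [] h"
  by (simp add: Rres_def)

lemma Lres_step:
  assumes "Lres f l h U a" "a \<le> p" "p < h" "f p = x" "\<And>i. a \<le> i \<Longrightarrow> i < p \<Longrightarrow> f i \<noteq> x"
  shows "Lres f l h (U @ [x]) (Suc p)"
proof -
  have "x \<notin> set (seg f a p)" using assms(5) by (auto simp: in_set_seg)
  then have "subseq (x # Y) (seg f a h) \<longleftrightarrow> subseq Y (seg f (Suc p) h)" for Y
    using assms(2,3,4) by (simp add: seg_split_at[of a p h] subseq_Cons_notin del: subseq_Cons2_iff)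
  then show ?thesis using assms by (auto simp: Lres_def)
qed

lemma Rres_step:
  assumes "Rres f l h V q" "l \<le> p" "p < q" "f p = x" "\<And>i. p < i \<Longrightarrow> i < q \<Longrightarrow> f i \<noteq> x"
  shows "Rres f l h (x # V) p"
proof -
  have *: "i \<le> q \<and> subseq (Y @ [x]) (seg f i q) \<longleftrightarrow> i \<le> p \<and> subseq Y (seg f i p)" for i Y
  proof (cases "i \<le> p")
    case True
    have "x \<notin> set (seg f (Suc p) q)" using assms(5) by (auto simp: in_set_seg)
    then show ?thesis
      using True assms(3,4) by (simp add: seg_split_at[of i p q] subseq_snoc_notin)
  next
    case False
    have "x \<notin> set (seg f i q)" using False assms(5) by (auto simp: in_set_seg)
    then have "\<not> subseq (Y @ [x]) (seg f i q)" using subseq_setD by fastforce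
    then show ?thesis using False by simp
  qed
  have "subseq (Y @ x # V) (seg f i h) \<longleftrightarrow> i \<le> p \<and> subseq Y (seg f i p)"
    if "l \<le> i" "i \<le> h" for i Y
    using Rres_iff[OF assms(1) that, of "Y @ [x]"] *[of i Y] by simp
  moreover have "l \<le> p" "p \<le> h" using assms(1-3) by (simp_all add: Rres_def)
  ultimately show ?thesis by (simp add: Rres_def)
qed

text \<open>Makes a failed push conclusive: the rightmost embedding leaves the most room before it,
  so if no \<open>x\<close> precedes it, then no other embedding helps.\<close>

lemma Rres_infeasible:
  assumes "Rres f l h V q" "x \<notin> set (seg f l q)"
  shows "\<not> subseq (x # V) (seg f l h)"
proof
  assume "subseq (x # V) (seg f l h)"
  then have "subseq ([x] @ V) (seg f l h)" by simp
  then have "subseq [x] (seg f l q)"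
    using Rres_iff[OF assms(1), of l "[x]"] assms(1) by (auto simp: Rres_def)
  then show False using assms(2) by (simp add: subseq_singleton_left)
qed

text \<open>Removing \<open>U\<close> moves the left end to \<open>a\<close>; this is why
  \<open>Rres\<close> speaks about all left ends \<open>i\<close>. Its conjunct
  \<open>i \<le> q\<close> matters because \<open>seg f i q\<close> is also empty for
  \<open>i > q\<close>.\<close>

lemma LRres_iff:
  assumes "Lres f l h U a" "Rres f l h V q" "a \<le> q"
  shows "subseq (U @ Y @ V) (seg f l h) \<longleftrightarrow> subseq Y (seg f a q)"
  using assms by (simp add: Lres_def Rres_def)

text \<open>
  A stack with \<open>j\<close> entries occupies the cells \<open>1, \<dots>, j\<close> of an array. Cell \<open>0\<close> of the arrays \<open>QA\<close>
  and \<open>QB\<close> below holds the end of the segment, a sentinel.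
\<close>

primrec stk :: "(nat \<Rightarrow> 'a) \<Rightarrow> nat \<Rightarrow> 'a list" where
  "stk V 0 = []"
| "stk V (Suc j) = V (Suc j) # stk V j"

lemma stk_cong: "(\<And>i. 1 \<le> i \<Longrightarrow> i \<le> j \<Longrightarrow> V i = V' i) \<Longrightarrow> stk V j = stk V' j"
  by (induction j) auto

lemma stk_upd [simp]: "j < k \<Longrightarrow> stk (V(k := x)) j = stk V j"
  by (rule stk_cong) auto

lemma length_stk [simp]: "length (stk V j) = j"
  by (induction j) auto

section \<open>Extending a common subsequence\<close>

definition common :: "(nat \<Rightarrow> 'a) \<Rightarrow> nat \<Rightarrow> nat \<Rightarrow> nat \<Rightarrow> nat \<Rightarrow> 'a list \<Rightarrow> bool" where
  "common f l1 h1 l2 h2 X \<longleftrightarrow> subseq X (seg f l1 h1) \<and> subseq X (seg f l2 h2)"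

definition maximal_common :: "(nat \<Rightarrow> 'a) \<Rightarrow> nat \<Rightarrow> nat \<Rightarrow> nat \<Rightarrow> nat \<Rightarrow> 'a list \<Rightarrow> bool" where
  "maximal_common f l1 h1 l2 h2 X \<longleftrightarrow>
     common f l1 h1 l2 h2 X \<and> (\<forall>Z. common f l1 h1 l2 h2 Z \<and> subseq X Z \<longrightarrow> Z = X)"

lemma common_subseq: "common f l1 h1 l2 h2 Z \<Longrightarrow> subseq X Z \<Longrightarrow> common f l1 h1 l2 h2 X"
  unfolding common_def using subseq_order.order_trans by blast

lemma maximal_commonI:
  assumes "common f l1 h1 l2 h2 X"
    and "\<And>X1 c X2. X = X1 @ X2 \<Longrightarrow> \<not> common f l1 h1 l2 h2 (X1 @ c # X2)"
  shows "maximal_common f l1 h1 l2 h2 X"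
  unfolding maximal_common_def
proof (intro conjI allI impI assms(1))
  fix Z assume Z: "common f l1 h1 l2 h2 Z \<and> subseq X Z"
  show "Z = X"
  proof (rule ccontr)
    assume "Z \<noteq> X"
    with Z obtain X1 c X2 where "X = X1 @ X2" "subseq (X1 @ c # X2) Z"
      by (metis strict_subseq_insertion)
    with Z assms(2) common_subseq show False by blast
  qed
qed

text \<open>
  Invariant of the greedy extension. The common subsequence is \<open>U\<close> followed by the stack \<open>V\<close>. The
  leftmost embeddings of \<open>U\<close> in the two segments end just before \<open>a\<close> and \<open>b\<close>, and the rightmost
  embeddings of the stack begin at \<open>QA sp\<close> and \<open>QB sp\<close>, so a letter fits between \<open>U\<close> and \<open>V\<close> iff the
  windows between these positions share it. The windows are scanned alternately from the left, and
  \<open>d\<close> counts the letters tested so far. The gaps before the end of \<open>U\<close> are already exhausted.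
\<close>

definition mcs_inv where
  "mcs_inv f l1 h1 l2 h2 U a b sp V QA QB d \<longleftrightarrow>
     Lres f l1 h1 U a \<and> Lres f l2 h2 U b \<and>
     (\<forall>j\<le>sp. Rres f l1 h1 (stk V j) (QA j) \<and> Rres f l2 h2 (stk V j) (QB j)) \<and>
     a + d div 2 \<le> QA sp \<and> b + d div 2 \<le> QB sp \<and>
     (\<forall>i<(d + 1) div 2. f (a + i) \<notin> set (seg f b (QB sp))) \<and>
     (\<forall>i<d div 2. f (b + i) \<notin> set (seg f a (QA sp))) \<and>
     (\<forall>U1 c U2. U = U1 @ U2 \<and> U2 \<noteq> [] \<longrightarrow> \<not> common f l1 h1 l2 h2 (U1 @ c # U2 @ stk V sp))"

lemma mcs_inv_scanned:
  assumes "mcs_inv f l1 h1 l2 h2 U a b sp V QA QB d"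
  shows "a \<le> i \<Longrightarrow> i < a + (d + 1) div 2 \<Longrightarrow> f i \<notin> set (seg f b (QB sp))"
    and "b \<le> i \<Longrightarrow> i < b + d div 2 \<Longrightarrow> f i \<notin> set (seg f a (QA sp))"
proof -
  have *: "\<forall>i<(d + 1) div 2. f (a + i) \<notin> set (seg f b (QB sp))"
    "\<forall>i<d div 2. f (b + i) \<notin> set (seg f a (QA sp))"
    using assms by (simp_all add: mcs_inv_def)
  show "a \<le> i \<Longrightarrow> i < a + (d + 1) div 2 \<Longrightarrow> f i \<notin> set (seg f b (QB sp))"
    using spec[OF *(1), of "i - a"] by simp
  show "b \<le> i \<Longrightarrow> i < b + d div 2 \<Longrightarrow> f i \<notin> set (seg f a (QA sp))"
    using spec[OF *(2), of "i - b"] by simp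
qed

lemma mcs_inv_init:
  assumes "l1 \<le> h1" "l2 \<le> h2" "QA 0 = h1" "QB 0 = h2"
  shows "mcs_inv f l1 h1 l2 h2 [] l1 l2 0 V QA QB 0"
  using assms by (simp add: mcs_inv_def Lres_Nil Rres_Nil)

text \<open>The count \<open>d\<close> survives a push. The windows lose letters only on the right,
  so what was missing stays missing. The pushed letter lies in both windows and hence was not among
  the letters found missing, so the new window ends do not cut into the tested part. Exhausted gaps
  stay exhausted because the common subsequence only grows.\<close>

lemma mcs_inv_push:
  assumes inv: "mcs_inv f l1 h1 l2 h2 U a b sp V QA QB d"
    and p: "a \<le> p" "p < QA sp" "f p = x" "\<And>i. p < i \<Longrightarrow> i < QA sp \<Longrightarrow> f i \<noteq> x"
    and r: "b \<le> r" "r < QB sp" "f r = x" "\<And>i. r < i \<Longrightarrow> i < QB sp \<Longrightarrow> f i \<noteq> x"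
  shows "mcs_inv f l1 h1 l2 h2 U a b (Suc sp) (V(Suc sp := x)) (QA(Suc sp := p)) (QB(Suc sp := r)) d"
proof -
  let ?V = "V(Suc sp := x)" and ?QA = "QA(Suc sp := p)" and ?QB = "QB(Suc sp := r)"
  have L: "l1 \<le> a" "l2 \<le> b" using inv by (auto simp: mcs_inv_def Lres_def)
  have R: "Rres f l1 h1 (x # stk V sp) p" "Rres f l2 h2 (x # stk V sp) r"
    using inv p r L by (auto simp: mcs_inv_def intro!: Rres_step)
  have 1: "\<forall>j\<le>Suc sp. Rres f l1 h1 (stk ?V j) (?QA j) \<and> Rres f l2 h2 (stk ?V j) (?QB j)"
    using inv R by (auto simp: mcs_inv_def le_Suc_eq)
  have sub: "set (seg f b r) \<subseteq> set (seg f b (QB sp))" "set (seg f a p) \<subseteq> set (seg f a (QA sp))"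
    using p r by (auto simp: set_seg)
  have mem: "x \<in> set (seg f a (QA sp))" "x \<in> set (seg f b (QB sp))"
    using p r by (metis in_set_seg)+
  have 2: "a + d div 2 \<le> p"
  proof (rule ccontr)
    assume "\<not> ?thesis"
    then have "p < a + (d + 1) div 2" by linarith
    then show False using mcs_inv_scanned(1)[OF inv p(1)] mem(2) p(3) by simp
  qed
  have 3: "b + d div 2 \<le> r"
  proof (rule ccontr)
    assume "\<not> ?thesis"
    then show False using mcs_inv_scanned(2)[OF inv r(1)] mem(1) r(3) by simp
  qed
  have 4: "\<not> common f l1 h1 l2 h2 (U1 @ c # U2 @ stk ?V (Suc sp))"
    if "U = U1 @ U2" "U2 \<noteq> []" for U1 c U2
  proof
    assume "common f l1 h1 l2 h2 (U1 @ c # U2 @ stk ?V (Suc sp))"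
    moreover have "subseq (U1 @ c # U2 @ stk V sp) (U1 @ c # U2 @ stk ?V (Suc sp))"
      unfolding stk.simps subseq_append' using subseq_append'[of "c # U2"] by auto
    ultimately have "common f l1 h1 l2 h2 (U1 @ c # U2 @ stk V sp)" by (rule common_subseq)
    then show False using inv that unfolding mcs_inv_def by blast
  qed
  show ?thesis using inv 1 2 3 4 sub unfolding mcs_inv_def by auto
qed

lemma mcs_inv_advance:
  assumes inv: "mcs_inv f l1 h1 l2 h2 U a b sp V QA QB d"
    and lt: "a + d div 2 < QA sp" "b + d div 2 < QB sp"
    and x: "x = (if even d then f (a + d div 2) else f (b + d div 2))"
    and fail: "x \<notin> set (seg f a (QA sp)) \<or> x \<notin> set (seg f b (QB sp))"
  shows "mcs_inv f l1 h1 l2 h2 U a b sp V QA QB (Suc d)"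
proof (cases "even d")
  case True
  have "x \<in> set (seg f a (QA sp))" using lt x True by (auto simp: set_seg)
  then have "x \<notin> set (seg f b (QB sp))" using fail by blast
  moreover have "(Suc d + 1) div 2 = Suc ((d + 1) div 2)" "(d + 1) div 2 = d div 2" "Suc d div 2 = d div 2"
    using True by auto
  ultimately show ?thesis using inv x True lt unfolding mcs_inv_def by (auto simp: less_Suc_eq)
next
  case False
  have "x \<in> set (seg f b (QB sp))" using lt x False by (auto simp: set_seg)
  then have "x \<notin> set (seg f a (QA sp))" using fail by blast
  moreover have "(Suc d + 1) div 2 = (d + 1) div 2" "Suc d div 2 = Suc (d div 2)"
    using False by (auto elim!: oddE)
  ultimately show ?thesis using inv x False lt unfolding mcs_inv_def by (auto simp: less_Suc_eq)
qed

text \<open>Having tested all letters of one window is enough for disjointness, so the alternating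
  scan may stop when the shorter window is used up.\<close>

lemma mcs_inv_exhausted:
  assumes inv: "mcs_inv f l1 h1 l2 h2 U a b sp V QA QB d"
    and ex: "\<not> (a + d div 2 < QA sp \<and> b + d div 2 < QB sp)"
  shows "\<not> common f l1 h1 l2 h2 (U @ c # stk V sp)"
    and "set (seg f a (QA sp)) \<inter> set (seg f b (QB sp)) = {}"
proof -
  show disj: "set (seg f a (QA sp)) \<inter> set (seg f b (QB sp)) = {}"
  proof (cases "a + d div 2 < QA sp")
    case False
    have "f i \<notin> set (seg f b (QB sp))" if "a \<le> i" "i < QA sp" for i
      using mcs_inv_scanned(1)[OF inv that(1)] that False by simp
    then show ?thesis by (auto simp: set_seg[of f a "QA sp"])
  next
    case True
    have "f i \<notin> set (seg f a (QA sp))" if "b \<le> i" "i < QB sp" for i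
      using mcs_inv_scanned(2)[OF inv that(1)] that True ex by simp
    then show ?thesis by (auto simp: set_seg[of f b "QB sp"])
  qed
  have "subseq (U @ [c] @ stk V sp) (seg f l1 h1) \<longleftrightarrow> subseq [c] (seg f a (QA sp))"
       "subseq (U @ [c] @ stk V sp) (seg f l2 h2) \<longleftrightarrow> subseq [c] (seg f b (QB sp))"
    using LRres_iff[of f l1 h1 U a "stk V sp" "QA sp" "[c]"] LRres_iff[of f l2 h2 U b "stk V sp" "QB sp" "[c]"] inv
    by (simp_all add: mcs_inv_def)
  then show "\<not> common f l1 h1 l2 h2 (U @ c # stk V sp)"
    using disj by (auto simp: common_def subseq_singleton_left)
qed

lemma mcs_inv_common:
  assumes "mcs_inv f l1 h1 l2 h2 U a b sp V QA QB d"
  shows "common f l1 h1 l2 h2 (U @ stk V sp)"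
  using assms LRres_iff[of f l1 h1 U a "stk V sp" "QA sp" "[]"] LRres_iff[of f l2 h2 U b "stk V sp" "QB sp" "[]"]
  by (simp add: mcs_inv_def common_def)

text \<open>An insertion into \<open>U\<close> falls either into an earlier gap, closed by the
  invariant, or behind the last letter, closed by the finished scan.\<close>

lemma mcs_inv_maximal:
  assumes inv: "mcs_inv f l1 h1 l2 h2 U a b 0 V QA QB d"
    and ex: "\<not> (a + d div 2 < QA 0 \<and> b + d div 2 < QB 0)"
  shows "maximal_common f l1 h1 l2 h2 U"
proof (rule maximal_commonI)
  show "common f l1 h1 l2 h2 U" using mcs_inv_common[OF inv] by simp
  show "\<not> common f l1 h1 l2 h2 (X1 @ c # X2)" if "U = X1 @ X2" for X1 c X2
  proof (cases "X2 = []")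
    case True
    then show ?thesis using mcs_inv_exhausted(1)[OF inv ex] that by simp
  next
    case False
    then show ?thesis using inv that by (simp add: mcs_inv_def)
  qed
qed

text \<open>
  If the two windows have no letter in common, then the next letter of the stack occurs for the
  first time at the end of one of them; this jump pays for the search.
\<close>

lemma mcs_inv_pop:
  assumes inv: "mcs_inv f l1 h1 l2 h2 U a b (Suc sp) V QA QB d"
    and ex: "\<not> (a + d div 2 < QA (Suc sp) \<and> b + d div 2 < QB (Suc sp))"
    and x: "x = V (Suc sp)"
    and p: "a \<le> p" "f p = x" "\<And>i. a \<le> i \<Longrightarrow> i < p \<Longrightarrow> f i \<noteq> x"
    and r: "b \<le> r" "f r = x" "\<And>i. b \<le> i \<Longrightarrow> i < r \<Longrightarrow> f i \<noteq> x"
  shows "mcs_inv f l1 h1 l2 h2 (U @ [x]) (Suc p) (Suc r) sp V QA QB 0"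
    and "a + b + d div 2 \<le> p + r" and "p < h1" "r < h2"
proof -
  have la: "Lres f l1 h1 U a" "Lres f l2 h2 U b" using inv by (auto simp: mcs_inv_def)
  have R: "Rres f l1 h1 (stk V sp) (QA sp)" "Rres f l2 h2 (stk V sp) (QB sp)"
    using inv by (auto simp: mcs_inv_def)
  have com: "common f l1 h1 l2 h2 (U @ [x] @ stk V sp)"
    using mcs_inv_common[OF inv] x by simp
  have *: "p < h1 \<and> Suc p \<le> QA sp" "r < h2 \<and> Suc r \<le> QB sp"
  proof -
    \<comment> \<open>As \<open>x # W\<close> still fits behind \<open>a\<close>, the leftmost
      \<open>x\<close> from \<open>a\<close> on precedes the embedding of \<open>W\<close> that
      belongs to the level below. It may well lie beyond the end of the current window.\<close>
    have aux: "p < h \<and> Suc p \<le> q"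
      if L: "Lres f l h U a" and R: "Rres f l h W q" and s: "subseq (U @ [x] @ W) (seg f l h)"
        and p: "a \<le> p" "f p = x" "\<And>i. a \<le> i \<Longrightarrow> i < p \<Longrightarrow> f i \<noteq> x" for l h W q a p
    proof -
      have 0: "subseq ([x] @ W) (seg f a h)" using L s by (simp add: Lres_def)
      then have "x \<in> set (seg f a q)" using L Rres_iff[OF R, of a "[x]"]
        by (auto simp: Lres_def subseq_singleton_left)
      then obtain i where "a \<le> i" "i < q" "f i = x" by (auto simp: in_set_seg)
      then have "p \<le> i" using p(3)[of i] not_le by blast
      then show ?thesis using \<open>i < q\<close> R by (simp add: Rres_def)
    qed
    show "p < h1 \<and> Suc p \<le> QA sp" using aux[OF la(1) R(1) _ p] com by (simp add: common_def)
    show "r < h2 \<and> Suc r \<le> QB sp" using aux[OF la(2) R(2) _ r] com by (simp add: common_def)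
  qed
  then show "p < h1" "r < h2" by auto
  have L: "Lres f l1 h1 (U @ [x]) (Suc p)" "Lres f l2 h2 (U @ [x]) (Suc r)"
    using la p r * by (auto intro: Lres_step)
  have gaps: "\<not> common f l1 h1 l2 h2 (U1 @ c # U2 @ stk V sp)"
    if U: "U @ [x] = U1 @ U2" "U2 \<noteq> []" for U1 c U2
  proof -
    obtain U2' where U2: "U2 = U2' @ [x]" "U = U1 @ U2'"
      using U by (cases U2 rule: rev_cases) (auto simp flip: append_assoc)
    show ?thesis
    proof (cases "U2' = []")
      case True
      then show ?thesis using mcs_inv_exhausted(1)[OF inv ex, of c] U2 x by simp
    next
      case False
      then have "\<not> common f l1 h1 l2 h2 (U1 @ c # U2' @ stk V (Suc sp))"
        using inv U2 unfolding mcs_inv_def by blast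
      then show ?thesis using U2 x by simp
    qed
  qed
  show "mcs_inv f l1 h1 l2 h2 (U @ [x]) (Suc p) (Suc r) sp V QA QB 0"
    using L inv * gaps unfolding mcs_inv_def by auto
  show "a + b + d div 2 \<le> p + r"
  proof (rule ccontr)
    assume "\<not> ?thesis"
    moreover have "a + d div 2 \<le> QA (Suc sp)" "b + d div 2 \<le> QB (Suc sp)"
      using inv by (auto simp: mcs_inv_def)
    ultimately have "p < QA (Suc sp)" "r < QB (Suc sp)" using p(1) r(1) by linarith+
    then have "x \<in> set (seg f a (QA (Suc sp)))" "x \<in> set (seg f b (QB (Suc sp)))"
      using p r by (metis in_set_seg)+
    then show False using mcs_inv_exhausted(2)[OF inv ex] by blast
  qed
qed

section \<open>Squares and a fixed letter\<close>

definition cnt :: "(nat \<Rightarrow> 'a) \<Rightarrow> 'a \<Rightarrow> nat \<Rightarrow> nat" where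
  "cnt f x q = count_list (seg f 0 q) x"

lemma cnt_0 [simp]: "cnt f x 0 = 0"
  by (simp add: cnt_def)

lemma cnt_Suc: "cnt f x (Suc q) = cnt f x q + (if f q = x then 1 else 0)"
  by (simp add: cnt_def seg_snoc)

lemma count_list_seg: "i \<le> j \<Longrightarrow> cnt f x j = cnt f x i + count_list (seg f i j) x"
  using seg_split[of 0 i j f] by (simp add: cnt_def)

lemma cnt_mono: "i \<le> j \<Longrightarrow> cnt f x i \<le> cnt f x j"
  by (simp add: count_list_seg)

lemma cnt_le: "cnt f x q \<le> q"
  unfolding cnt_def using count_le_length[of "seg f 0 q" x] by simp

lemma cnt_less: "f i = x \<Longrightarrow> i < j \<Longrightarrow> cnt f x i < cnt f x j"
  using cnt_mono[of "Suc i" j f x] by (simp add: cnt_Suc)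

lemma cnt_less_imp: "cnt f x i < cnt f x j \<Longrightarrow> i < j"
  using cnt_mono[of j i f x] by (meson leD not_le)

lemma notin_seg_iff: "i \<le> j \<Longrightarrow> x \<notin> set (seg f i j) \<longleftrightarrow> cnt f x j = cnt f x i"
  by (simp add: count_list_seg count_list_0_iff)

lemma Lres_subseq:
  assumes "Lres f l h U a"
  shows "subseq U (seg f l a)"
proof -
  have "subseq (U @ seg f a h) (seg f l h)"
    using Lres_iff[OF assms, of "seg f a h"] by simp
  moreover have "seg f l h = seg f l a @ seg f a h"
    using assms seg_split[of l a h f] by (simp add: Lres_def)
  ultimately show ?thesis by (simp only: subseq_append)
qed

text \<open>Apply the characterisation to the whole remainder \<open>seg f s h\<close>: it must
  embed behind \<open>a\<close>, and comparing lengths bounds \<open>a\<close>.\<close>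

lemma Lres_least:
  assumes "Lres f l h U a" "subseq U (seg f l s)" "l \<le> s" "s \<le> h"
  shows "a \<le> s"
proof -
  have "subseq (U @ seg f s h) (seg f l h)"
    using assms by (intro subseq_append_segI) simp_all
  then have "subseq (seg f s h) (seg f a h)"
    using Lres_iff[OF assms(1), of "seg f s h"] by simp
  from list_emb_length[OF this] have "h - s \<le> h - a" by simp
  moreover have "a \<le> h" using assms(1) by (simp add: Lres_def)
  ultimately show ?thesis using assms(4) by linarith
qed

lemma subseq_snoc_last: "subseq Z (Y @ [c]) \<Longrightarrow> Z = [] \<or> last Z \<noteq> c \<Longrightarrow> subseq Z Y"
proof -
  assume Z: "subseq Z (Y @ [c])" "Z = [] \<or> last Z \<noteq> c"
  obtain A B where AB: "Z = A @ B" "subseq A Y" "subseq B [c]"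
    using Z(1) by (rule subseq_appendE)
  have "B = []"
  proof (rule ccontr)
    assume "B \<noteq> []"
    then have "last Z \<in> set [c]" using AB(1) subseq_setD[OF AB(3)] by (metis last_appendR last_in_set subsetD)
    then show False using Z(2) AB(1) \<open>B \<noteq> []\<close> by simp
  qed
  then show ?thesis using AB by simp
qed

text \<open>Cut the embedding behind \<open>Y @ [c]\<close>. If a nonempty piece of \<open>V\<close>
  came before the cut, then the part before the cut would not end in \<open>c\<close> and would fit
  into \<open>Y\<close>, although it contains \<open>m\<close> letters \<open>c\<close>.\<close>

lemma subseq_block_tail:
  assumes "subseq (replicate m c @ V) (Y @ [c] @ V')" "count_list Y c < m" "c \<notin> set V"
  shows "subseq V V'"
proof -
  have "subseq (replicate m c @ V) ((Y @ [c]) @ V')" using assms(1) by simp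
  then obtain Z1 Z2 where Z: "replicate m c @ V = Z1 @ Z2" "subseq Z1 (Y @ [c])" "subseq Z2 V'"
    by (rule subseq_appendE)
  from Z(1)[unfolded append_eq_append_conv2] obtain us
    where us: "replicate m c = Z1 @ us \<and> us @ V = Z2 \<or> replicate m c @ us = Z1 \<and> V = us @ Z2" ..
  show ?thesis
  proof (cases "us = []")
    case True
    then have "V = Z2" using us by auto
    then show ?thesis using Z(3) by simp
  next
    case False
    from us show ?thesis
    proof
      assume "replicate m c = Z1 @ us \<and> us @ V = Z2"
      then have "subseq V Z2" using subseq_drop_many[of V V us] by simp
      then show ?thesis using Z(3) by (rule subseq_order.order_trans)
    next
      assume *: "replicate m c @ us = Z1 \<and> V = us @ Z2"
      then have "last Z1 \<in> set V" using False by auto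
      then have "last Z1 \<noteq> c" using assms(3) by blast
      then have "subseq Z1 Y" using subseq_snoc_last[OF Z(2)] by simp
      then have "count_list Z1 c \<le> count_list Y c" by (rule subseq_count_list)
      moreover have "m \<le> count_list Z1 c" using * by (simp add: count_list_replicate flip: conjunct1[OF *])
      ultimately show ?thesis using assms(2) by linarith
    qed
  qed
qed

text \<open>
  A letter that occurs for the first time after the last repeated letter cannot be part of a square.
\<close>

lemma subseq_square_tail:
  assumes "subseq (X @ X) (P @ T)" "distinct T" "set P \<inter> set T = {}"
  shows "subseq (X @ X) P"
proof -
  obtain A B where AB: "X @ X = A @ B" "subseq A P" "subseq B T"
    using assms(1) by (rule subseq_appendE)
  have "B = []"
  proof (rule ccontr)
    assume "B \<noteq> []"
    then have X: "X \<noteq> []" using AB(1) by (metis append_is_Nil_conv)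
    have "last X = last B" using \<open>B \<noteq> []\<close> X AB(1) by (metis last_appendR)
    then have "last X \<in> set B" using \<open>B \<noteq> []\<close> by simp
    then have T: "last X \<in> set T" using subseq_setD[OF AB(3)] by blast
    then have "last X \<notin> set A" using subseq_setD[OF AB(2)] assms(3) by blast
    moreover have "2 \<le> count_list (A @ B) (last X)"
    proof -
      have "count_list X (last X) \<noteq> 0" using X by (simp add: count_list_0_iff)
      then show ?thesis unfolding AB(1)[symmetric] by simp
    qed
    moreover have "count_list T (last X) \<le> 1" using assms(2) by (induction T) auto
    ultimately show False
      using subseq_count_list[OF AB(3), of "last X"] by simp
  qed
  then show ?thesis using AB by simp
qed

text \<open>
  The letter \<open>c\<close> has its \<open>m\<close>-th occurrence at \<open>p\<close>, its \<open>(m + 1)\<close>-th at \<open>p'\<close>, its \<open>2 m\<close>-th at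
  \<open>r\<close> and its last one at \<open>e\<close>. A square whose half contains \<open>c ^ m\<close> uses all occurrences of \<open>c\<close>
  but at most one, so there are only two places where its first half can end.
\<close>

definition repeated_letter where
  "repeated_letter f c m p p' r e \<longleftrightarrow> 1 \<le> m \<and> f p = c \<and> cnt f c p = m - 1 \<and> f p' = c \<and> cnt f c p' = m \<and>
     f r = c \<and> cnt f c r = 2 * m - 1 \<and> f e = c \<and> 2 * m \<le> cnt f c (Suc e) \<and> cnt f c (Suc e) \<le> 2 * m + 1"

lemma repeated_letter_order:
  assumes "repeated_letter f c m p p' r e"
  shows "p < p'" "p' \<le> r" "r \<le> e" 
proof -
  show "p < p'" using assms by (rule_tac cnt_less_imp[of f c]) (auto simp: repeated_letter_def)
  have "p' < Suc r" using assms by (rule_tac cnt_less_imp[of f c]) (auto simp: repeated_letter_def cnt_Suc)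
  then show "p' \<le> r" by simp
  have "r < Suc e" using assms by (rule_tac cnt_less_imp[of f c]) (auto simp: repeated_letter_def)
  then show "r \<le> e" by simp
qed

text \<open>Shows that the first of the two refinements is always feasible. The second
  \<open>c ^ m\<close> can use the \<open>m\<close> occurrences from \<open>p'\<close> to
  \<open>r\<close>, none of which precedes \<open>v\<close>.\<close>

lemma repeated_letter_start:
  assumes rep: "repeated_letter f c m p p' r e"
    and V: "common f (Suc p) p' (Suc r) (Suc e) V" "Lres f (Suc p) p' V v"
  shows "common f 0 v v (Suc e) (replicate m c @ V)"
proof -
  note ord = repeated_letter_order[OF rep]
  have v: "Suc p \<le> v" "v \<le> p'" using V(2) by (auto simp: Lres_def)
  have "subseq (replicate m c) (seg f 0 (Suc p))"
    using rep by (auto simp: subseq_replicate_iff repeated_letter_def simp flip: cnt_def simp: cnt_Suc)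
  moreover have "subseq (replicate m c) (seg f p' (Suc r))"
    using count_list_seg[of p' "Suc r" f c] rep ord by (auto simp: subseq_replicate_iff repeated_letter_def cnt_Suc)
  ultimately have "subseq (replicate m c @ V) (seg f 0 v)" "subseq (replicate m c @ V) (seg f p' (Suc e))"
    using V(1) Lres_subseq[OF V(2)] ord v
    using subseq_append_segI[of "replicate m c" f 0 "Suc p" V v] subseq_append_segI[of "replicate m c" f p' "Suc r" V "Suc e"]
    by (simp_all add: common_def)
  then show ?thesis using v subseq_segI[of _ f p' "Suc e" v] by (simp add: common_def)
qed

text \<open>Split \<open>Z\<close> at its last \<open>c\<close> as \<open>Y @ c # V'\<close>; then
  \<open>V\<close> is a subsequence of \<open>V'\<close>. If the cut \<open>s\<close> is at most
  \<open>p'\<close>, the last \<open>c\<close> of the first half can be placed at \<open>p\<close>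
  and that of the second half is at \<open>r\<close> or later. So \<open>V'\<close> is common to the
  two gaps, it equals \<open>V\<close> by maximality, and the first half can end at
  \<open>v\<close>. If \<open>s\<close> is beyond \<open>p'\<close>, the second half needs all
  remaining occurrences up to the one at \<open>e\<close>, so \<open>V'\<close> is empty and the
  first half can end with the \<open>c\<close> at \<open>p'\<close>.\<close>

lemma repeated_letter_cases:
  assumes rep: "repeated_letter f c m p p' r e"
    and V: "maximal_common f (Suc p) p' (Suc r) (Suc e) V" "Lres f (Suc p) p' V v"
    and Z: "subseq (replicate m c @ V) Z" "subseq (Z @ Z) (seg f 0 (Suc e))"
  shows "common f 0 v v (Suc e) Z \<or> common f 0 (Suc p') (Suc p') (Suc e) Z"
proof -
  note ord = repeated_letter_order[OF rep]
  have m: "1 \<le> m" and fc: "f p = c" "f p' = c" "f r = c" "f e = c"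
    and cp: "cnt f c p = m - 1" "cnt f c p' = m" "cnt f c r = 2 * m - 1"
      "cnt f c (Suc p) = m" "cnt f c (Suc p') = Suc m" "cnt f c (Suc r) = 2 * m"
    and ce: "cnt f c (Suc e) = Suc (cnt f c e)" "2 * m \<le> cnt f c (Suc e)" "cnt f c (Suc e) \<le> 2 * m + 1"
    using rep by (auto simp: repeated_letter_def cnt_Suc)
  obtain s where s: "s \<le> Suc e" "subseq Z (seg f 0 s)" "subseq Z (seg f s (Suc e))"
    using Z(2) by (rule subseq_append_segE) auto
  have "m \<le> count_list Z c"
    using subseq_count_list[OF Z(1), of c] by (simp add: count_list_replicate)
  moreover have cs: "count_list Z c \<le> cnt f c s" "cnt f c s + count_list Z c \<le> cnt f c (Suc e)"
    using subseq_count_list[OF s(2), of c] subseq_count_list[OF s(3), of c] count_list_seg[OF s(1), of f c]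
    by (simp_all add: cnt_def)
  \<comment> \<open>Two disjoint copies of \<open>Z\<close> share at most \<open>2 * m + 1\<close>
    occurrences of \<open>c\<close>, and each needs at least \<open>m\<close>.\<close>
  ultimately have cZ: "count_list Z c = m" using ce by linarith
  then have "c \<in> set Z" using m by (metis count_list_0_iff not_one_le_zero)
  then obtain Y V' where YV: "Z = Y @ c # V'" "c \<notin> set V'" by (meson split_list_last)
  then have cY: "count_list Y c = m - 1" using cZ by simp
  have ZYV: "Z = (Y @ [c]) @ V'" using YV by simp
  have cV: "c \<notin> set V"
  proof -
    have "c \<notin> set (seg f (Suc p) p')" using notin_seg_iff[of "Suc p" p' c f] ord cp by simp
    then show ?thesis using V(1) subseq_setD by (fastforce simp: maximal_common_def common_def)
  qed
  have VV': "subseq V V'"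
    using Z(1) cY m cV by (intro subseq_block_tail[of m c V Y V']) (auto simp: YV)
  obtain i where i: "i \<le> s" "subseq (Y @ [c]) (seg f 0 i)" "subseq V' (seg f i s)"
    using s(2) unfolding ZYV by (rule subseq_append_segE) auto
  obtain j where j: "s \<le> j" "j \<le> Suc e" "subseq (Y @ [c]) (seg f s j)" "subseq V' (seg f j (Suc e))"
    using s(3) unfolding ZYV by (rule subseq_append_segE) (use s(1) in auto)
  have ci: "m \<le> cnt f c i" using subseq_count_list[OF i(2), of c] cY m by (simp add: cnt_def)
  have cj: "cnt f c s + m \<le> cnt f c j"
    using subseq_count_list[OF j(3), of c] cY m count_list_seg[OF j(1), of f c] by simp
  have pi: "Suc p \<le> i" using ci cp(1) m cnt_less_imp[of f c p i] by linarith
  \<comment> \<open>A word ending in \<open>c\<close> can be cut back to just behind the last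
    available \<open>c\<close>; below, \<open>q\<close> is \<open>Suc p\<close> or
    \<open>Suc p'\<close>.\<close>
  have snoc: "subseq (Y @ [c]) (seg f 0 q)"
    if "subseq (Y @ [c]) (seg f 0 k)" "q \<le> k" "cnt f c k = cnt f c q" for q k
    using subseq_snoc_rev[of Y c "seg f 0 q" "seg f q k"] that notin_seg_iff[of q k c f] seg_split[of 0 q k f] by simp
  show ?thesis
  proof (cases "s \<le> p'")
    case True
    then have "cnt f c s = m" using cnt_mono[OF True, of f c] cp cs cZ by simp
    have "cnt f c i = m" using ci cnt_mono[OF i(1), of f c] \<open>cnt f c s = m\<close> by simp
    then have Yp: "subseq (Y @ [c]) (seg f 0 (Suc p))" using snoc[OF i(2) pi] cp by simp
    have "Suc r \<le> j" using cj \<open>cnt f c s = m\<close> cp(3) m cnt_less_imp[of f c r j] by linarith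
    then have "common f (Suc p) p' (Suc r) (Suc e) V'"
      using subseq_segI[OF i(3) pi True] subseq_segI[OF j(4) _ order_refl] by (simp add: common_def)
    then have "V' = V" using V(1) VV' by (simp add: maximal_common_def)
    have "subseq V (seg f (Suc p) s)" using subseq_segI[OF i(3) pi order_refl] \<open>V' = V\<close> by simp
    then have vs: "v \<le> s" using Lres_least[OF V(2), of s] pi i(1) True by simp
    have "Suc p \<le> v" using V(2) by (simp add: Lres_def)
    then have "subseq Z (seg f 0 v)"
      unfolding ZYV \<open>V' = V\<close> using subseq_append_segI[OF Yp Lres_subseq[OF V(2)]] by simp
    then show ?thesis using subseq_segI[OF s(3) vs order_refl] by (simp add: common_def)
  next
    case False
    then have "Suc m \<le> cnt f c s" using cp(5) cnt_mono[of "Suc p'" s f c] by simp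
    then have "cnt f c e < cnt f c j" and cs': "cnt f c s = Suc m"
      using cj ce cs cZ cnt_mono[OF j(2), of f c] by linarith+
    then have "j = Suc e" using cnt_less_imp[of f c e j] j(2) by simp
    then have "V' = []" using j(4) by simp
    then have "subseq Z (seg f 0 (Suc p'))"
      using snoc[of s "Suc p'"] s(2) cs' cp(5) False by (simp add: YV)
    then show ?thesis using subseq_segI[OF s(3) _ order_refl, of "Suc p'"] False by (simp add: common_def)
  qed
qed

text \<open>Why the second refinement does not spoil the first: a larger \<open>Z\<close> at the
  first cut equals \<open>X\<close> and is thus squeezed onto \<open>X'\<close>. A larger
  \<open>Z\<close> at the second cut shows that \<open>X\<close> is feasible there, so
  \<open>X'\<close> is maximal at that cut.\<close>

lemma repeated_letter_maximal:
  assumes rep: "repeated_letter f c m p p' r e"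
    and V: "maximal_common f (Suc p) p' (Suc r) (Suc e) V" "Lres f (Suc p) p' V v"
    and X: "subseq (replicate m c @ V) X" "maximal_common f 0 v v (Suc e) X"
    and X': "subseq X X'" "maximal_common f 0 (Suc p') (Suc p') (Suc e) X' \<or>
       X' = X \<and> \<not> common f 0 (Suc p') (Suc p') (Suc e) X"
  shows "subseq (X' @ X') (seg f 0 (Suc e))"
    and "subseq (Z @ Z) (seg f 0 (Suc e)) \<Longrightarrow> subseq X' Z \<Longrightarrow> Z = X'"
proof -
  note ord = repeated_letter_order[OF rep]
  have v: "v \<le> Suc e" using V(2) ord by (simp add: Lres_def)
  show "subseq (X' @ X') (seg f 0 (Suc e))"
    using X' X(2) v ord subseq_append_segI[of X' f 0 v X' "Suc e"] subseq_append_segI[of X' f 0 "Suc p'" X' "Suc e"]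
    by (auto simp: maximal_common_def common_def)
  assume Z: "subseq (Z @ Z) (seg f 0 (Suc e))" "subseq X' Z"
  have XZ: "subseq X Z" using X'(1) Z(2) by (rule subseq_order.order_trans)
  have "subseq (replicate m c @ V) Z" using X(1) XZ by (rule subseq_order.order_trans)
  from repeated_letter_cases[OF rep V this Z(1)] show "Z = X'"
  proof
    assume "common f 0 v v (Suc e) Z"
    then have "Z = X" using X(2) XZ by (simp add: maximal_common_def)
    then show ?thesis using X'(1) Z(2) subseq_order.order_antisym[of X' X] by simp
  next
    assume *: "common f 0 (Suc p') (Suc p') (Suc e) Z"
    then have "common f 0 (Suc p') (Suc p') (Suc e) X" using XZ by (rule common_subseq)
    then show ?thesis using X'(2) * Z(2) by (simp add: maximal_common_def)
  qed
qed

lemma maximal_square_subseqI: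
  assumes "subseq (X @ X) S" "\<And>Z. subseq (Z @ Z) S \<Longrightarrow> subseq X Z \<Longrightarrow> Z = X"
  shows "maximal_square_subseq (X @ X) S"
  unfolding maximal_square_subseq_def square_subseq_def
proof (intro conjI notI; (elim exE conjE)?)
  show "subseq (X @ X) S" by (rule assms(1))
  fix B' Z assume "strict_subseq (X @ X) B'" "B' = Z @ Z" "subseq B' S"
  then show False using assms(2)[of Z] by (auto simp: subseq_square_iff subseq_order.less_le)
qed blast

section \<open>Program logic\<close>

text \<open>The postcondition also receives the running time, so termination, result and cost are
  established in one pass over a program.\<close>

definition wp :: "nat \<Rightarrow> com \<Rightarrow> (nat \<Rightarrow> state \<Rightarrow> bool) \<Rightarrow> state \<Rightarrow> bool" where
  "wp w c Q s \<longleftrightarrow> (\<exists>t s'. exec w c s t s' \<and> Q t s')"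

lemma wp_mono: "wp w c Q s \<Longrightarrow> (\<And>t s'. Q t s' \<Longrightarrow> R t s') \<Longrightarrow> wp w c R s"
  unfolding wp_def by blast

lemma wp_Skip [simp]: "wp w Skip Q s \<longleftrightarrow> Q 1 s"
  unfolding wp_def by (metis exec_elims(1) exec.Skip)

lemma wp_Assign [simp]:
  "wp w (Assign x e) Q s \<longleftrightarrow> Q (expr_cost e + 1) (s\<lparr>reg := (reg s)(x := expr_val w e s)\<rparr>)"
  unfolding wp_def by (metis exec_elims(2) exec.Assign)

lemma wp_Store [simp]:
  "wp w (Store a i e) Q s \<longleftrightarrow> Q (expr_cost i + expr_cost e + 1)
     (s\<lparr>arr := (arr s)(a := (arr s a)(expr_val w i s := expr_val w e s))\<rparr>)"
  unfolding wp_def by (metis exec_elims(3) exec.Store)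

lemma wp_Seq [simp]:
  "wp w (Seq c1 c2) Q s \<longleftrightarrow> wp w c1 (\<lambda>t1. wp w c2 (\<lambda>t2. Q (t1 + t2))) s"
  unfolding wp_def by (blast elim: exec_elims(4) intro: exec.Seq)

lemma wp_Ite [simp]:
  "wp w (Ite b c1 c2) Q s \<longleftrightarrow>
     (if cond_val w b s then wp w c1 (\<lambda>t. Q (cond_cost b + t + 1)) s
      else wp w c2 (\<lambda>t. Q (cond_cost b + t + 1)) s)"
proof (cases "cond_val w b s")
  case True
  have "exec w (Ite b c1 c2) s t s' \<longleftrightarrow> (\<exists>t1. t = cond_cost b + t1 + 1 \<and> exec w c1 s t1 s')" for t s'
  proof
    assume "exec w (Ite b c1 c2) s t s'"
    then show "\<exists>t1. t = cond_cost b + t1 + 1 \<and> exec w c1 s t1 s'"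
      by (rule exec_elims(5)) (use True in auto)
  qed (use True exec.IteTrue in blast)
  then show ?thesis using True unfolding wp_def by auto
next
  case False
  have "exec w (Ite b c1 c2) s t s' \<longleftrightarrow> (\<exists>t1. t = cond_cost b + t1 + 1 \<and> exec w c2 s t1 s')" for t s'
  proof
    assume "exec w (Ite b c1 c2) s t s'"
    then show "\<exists>t1. t = cond_cost b + t1 + 1 \<and> exec w c2 s t1 s'"
      by (rule exec_elims(5)) (use False in auto)
  qed (use False exec.IteFalse in blast)
  then show ?thesis using False unfolding wp_def by auto
qed

text \<open>Amortised rule: \<open>K\<close> pays for one iteration together with its test, every
  iteration lowers \<open>\<Phi>\<close>, and the final failing test is paid separately.\<close>

lemma wp_While:
  fixes \<Phi> :: "state \<Rightarrow> nat"
  assumes "I s"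
    and body: "\<And>s. I s \<Longrightarrow> cond_val w b s \<Longrightarrow>
      wp w c (\<lambda>t s'. I s' \<and> \<Phi> s' < \<Phi> s \<and> t + cond_cost b + 1 \<le> K) s"
    and exit: "\<And>t s'. I s' \<Longrightarrow> \<not> cond_val w b s' \<Longrightarrow> t \<le> K * \<Phi> s + cond_cost b + 1 \<Longrightarrow> Q t s'"
  shows "wp w (While b c) Q s"
proof -
  have "\<exists>t s'. exec w (While b c) s t s' \<and> I s' \<and> \<not> cond_val w b s' \<and> t \<le> K * \<Phi> s + cond_cost b + 1"
    using assms(1)
  proof (induction "\<Phi> s" arbitrary: s rule: less_induct)
    case less
    show ?case
    proof (cases "cond_val w b s")
      case True
      then obtain t1 s1 where 1: "exec w c s t1 s1" "I s1" "\<Phi> s1 < \<Phi> s" "t1 + cond_cost b + 1 \<le> K"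
        using body[OF less.prems] unfolding wp_def by blast
      obtain t2 s2 where 2: "exec w (While b c) s1 t2 s2" "I s2" "\<not> cond_val w b s2"
          "t2 \<le> K * \<Phi> s1 + cond_cost b + 1"
        using less.hyps[OF 1(3,2)] by blast
      have "K * \<Phi> s1 + K \<le> K * \<Phi> s"
        using 1(3) mult_le_mono2[of "Suc (\<Phi> s1)" "\<Phi> s" K] by simp
      then have "cond_cost b + t1 + t2 + 1 \<le> K * \<Phi> s + cond_cost b + 1" using 1(4) 2(4) by linarith
      then show ?thesis using exec.WhileTrue[OF True 1(1) 2(1)] 2 by blast
    next
      case False
      then show ?thesis using exec.WhileFalse[OF False] less.prems by (intro exI[of _ "cond_cost b + 1"] exI[of _ s]) simp
    qed
  qed
  then show ?thesis using exit unfolding wp_def by blast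
qed

fun block :: "com list \<Rightarrow> com" where
  "block [] = Skip"
| "block [c] = c"
| "block (c # cs) = Seq c (block cs)"

abbreviation "add \<equiv> Op Add"
abbreviation "sub \<equiv> Op Sub"
abbreviation "half e \<equiv> Op Div e (Const 2)"

text \<open>
  The tables built once from the input: \<open>CNT x\<close> counts the occurrences of the letter \<open>x\<close>, and
  \<open>OCC (BASE x + k)\<close> is one plus the position of its \<open>k\<close>-th occurrence, with \<open>0\<close> for \<open>k = 0\<close>.
\<close>

definition static :: "(nat \<Rightarrow> nat) \<Rightarrow> nat \<Rightarrow> nat \<Rightarrow> nat \<Rightarrow> (string \<Rightarrow> nat) \<Rightarrow> (string \<Rightarrow> nat \<Rightarrow> nat) \<Rightarrow> bool" where
  "static f n e p R A \<longleftrightarrow> R ''n'' = n \<and> R ''e'' = e \<and> R ''f'' = p \<and> A ''S'' = f \<and>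
     (\<forall>x. A ''CNT'' x = cnt f x n) \<and>
     (\<forall>x. 0 < cnt f x n \<longrightarrow> A ''BASE'' x + n < (n + 2)\<^sup>2 \<and> A ''OCC'' (A ''BASE'' x) = 0 \<and>
       (\<forall>k < cnt f x n. \<exists>i<n. f i = x \<and> cnt f x i = k \<and> A ''OCC'' (A ''BASE'' x + k + 1) = i + 1))"

lemma static_reg [simp]:
  "r \<notin> {''n'', ''e'', ''f''} \<Longrightarrow> static f n e p (R(r := v)) A \<longleftrightarrow> static f n e p R A"
  by (auto simp: static_def)

lemma static_arr [simp]:
  "a \<notin> {''S'', ''CNT'', ''BASE'', ''OCC''} \<Longrightarrow> static f n e p R (A(a := v)) \<longleftrightarrow> static f n e p R A"
  by (auto simp: static_def)

lemma cnt_pos: "i < n \<Longrightarrow> 0 < cnt f (f i) n"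
  using cnt_less[of f i "f i" n] by simp

lemma last_occurrence:
  assumes "f i = x" "cnt f x i = k" "cnt f x q = Suc k"
  shows "i < q" "\<And>j. i < j \<Longrightarrow> j < q \<Longrightarrow> f j \<noteq> x"
proof -
  show "i < q" using assms by (simp add: cnt_less_imp[of f x])
  show "f j \<noteq> x" if "i < j" "j < q" for j
    using cnt_less[of f j x q] cnt_less[of f i x j] that assms by fastforce
qed

lemma next_occurrence:
  assumes "f i = x" "cnt f x i = cnt f x a"
  shows "a \<le> i" "\<And>j. a \<le> j \<Longrightarrow> j < i \<Longrightarrow> f j \<noteq> x"
proof -
  show "a \<le> i" using cnt_less[of f i x a] assms by (rule_tac ccontr) simp
  show "f j \<noteq> x" if "a \<le> j" "j < i" for j
    using cnt_less[of f j x i] cnt_mono[OF that(1), of f x] that assms by fastforce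
qed

section \<open>Bisection in the list of occurrences of a letter\<close>

definition search_step :: com where
  "search_step = block
    [Assign ''y'' (half (add (add (Reg ''k'') (Reg ''l'')) (Const 1))),
     Ite (Less (Reg ''q'') (Load ''OCC'' (add (Reg ''h'') (Reg ''y''))))
       (Assign ''l'' (sub (Reg ''y'') (Const 1)))
       (Assign ''k'' (Reg ''y''))]"

definition search_loop :: com where
  "search_loop = While (Less (Reg ''k'') (Reg ''l'')) search_step"

definition search :: com where
  "search = block
    [Assign ''h'' (Load ''BASE'' (Reg ''x'')),
     Assign ''k'' (Const 0),
     Assign ''l'' (Load ''CNT'' (Reg ''x'')),
     search_loop]"

lemma floorlog_half: "0 < k \<Longrightarrow> j \<le> k div 2 \<Longrightarrow> floorlog 2 j < floorlog 2 k" for j k :: nat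
  using floorlog_mono[of j "k div 2" 2] compute_floorlog[of 2 k] by simp

text \<open>Bisects on the number of occurrences before \<open>q\<close>. The width
  \<open>l - k\<close> is at least halved in each round, so its \<open>floorlog\<close> falls. The
  bound on \<open>w\<close> keeps all table addresses from wrapping around.\<close>

lemma wp_search:
  assumes st: "static f n e p (reg s) (arr s)" and w: "(n + 2)\<^sup>2 \<le> 2 ^ w"
    and x: "x = reg s ''x''" "0 < cnt f x n" and q: "q = reg s ''q''" "q \<le> n"
    and Q: "\<And>t l y. t \<le> 40 * (floorlog 2 n + 1) \<Longrightarrow>
      Q t (s\<lparr>reg := (reg s)(''h'' := arr s ''BASE'' x, ''k'' := cnt f x q, ''l'' := l, ''y'' := y)\<rparr>)"
  shows "wp w search Q s"
proof -
  let ?H = "arr s ''BASE'' x"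
  have "(n + 2)\<^sup>2 = n * n + 4 * n + 4" by (simp add: power2_eq_square algebra_simps)
  then have M: "n * n + 4 * n + 4 \<le> 2 ^ w" using w by simp
  have "?H + n < (n + 2)\<^sup>2"
    using st x(2) unfolding static_def by blast
  then have H: "?H + n < 2 ^ w" using w by (rule less_le_trans)
  have C: "arr s ''CNT'' x = cnt f x n" using st by (simp add: static_def)
  have O: "\<And>k. k < cnt f x n \<Longrightarrow> \<exists>i<n. f i = x \<and> cnt f x i = k \<and> arr s ''OCC'' (?H + k + 1) = i + 1"
    using st x(2) unfolding static_def by blast
  have cn: "cnt f x n \<le> n" by (rule cnt_le)
  have qn: "cnt f x q \<le> cnt f x n" using q by (simp add: cnt_mono)
  \<comment> \<open>Entries are successors of positions, so the strict test succeeds iff the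
    occurrence number \<open>y\<close> is at \<open>q\<close> or later.\<close>
  have cmp: "q < arr s ''OCC'' (?H + y) \<longleftrightarrow> cnt f x q < y" if y: "0 < y" "y \<le> cnt f x n" for y
  proof -
    obtain i where i: "f i = x" "cnt f x i = y - 1" "arr s ''OCC'' (?H + y) = i + 1"
      using O[of "y - 1"] y by (cases y) auto
    show ?thesis using i that cnt_mono[of q i f x] cnt_less[of f i x q] by (cases "q \<le> i") auto
  qed
  define I where "I s' \<longleftrightarrow> (\<exists>k l y. s' = s\<lparr>reg := (reg s)(''h'' := ?H, ''k'' := k, ''l'' := l, ''y'' := y)\<rparr> \<and>
    k \<le> cnt f x q \<and> cnt f x q \<le> l \<and> l \<le> cnt f x n)" for s'
  let ?s0 = "s\<lparr>reg := (reg s)(''h'' := ?H, ''k'' := 0, ''l'' := cnt f x n)\<rparr>"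
  have "w \<noteq> 0" using M by (intro notI) simp
  have loop: "wp w search_loop (\<lambda>t s'. t \<le> 30 * floorlog 2 n + 10 \<and>
    (\<exists>l y. s' = s\<lparr>reg := (reg s)(''h'' := ?H, ''k'' := cnt f x q, ''l'' := l, ''y'' := y)\<rparr>)) ?s0"
    unfolding search_loop_def
  proof (rule wp_While[where I = I and \<Phi> = "\<lambda>s. floorlog 2 (reg s ''l'' - reg s ''k'')" and K = 30])
    show "I (s\<lparr>reg := (reg s)(''h'' := ?H, ''k'' := 0, ''l'' := cnt f x n)\<rparr>)"
      unfolding I_def using qn
      by (intro exI[of _ 0] exI[of _ "cnt f x n"] exI[of _ "reg s ''y''"]) (auto simp: fun_eq_iff)
  next
    fix s1 assume "I s1" and c: "cond_val w (Less (Reg ''k'') (Reg ''l'')) s1"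
    then obtain k l y where s1: "s1 = s\<lparr>reg := (reg s)(''h'' := ?H, ''k'' := k, ''l'' := l, ''y'' := y)\<rparr>"
      and kl: "k \<le> cnt f x q" "cnt f x q \<le> l" "l \<le> cnt f x n" "k < l"
      unfolding I_def by auto
    \<comment> \<open>Rounding the midpoint up ensures \<open>k < y'\<close>, so that setting
      \<open>k\<close> to \<open>y'\<close> makes progress.\<close>
    define y' where "y' = Suc (k + l) div 2"
    have y': "k < y'" "y' \<le> l" "0 < y'" "y' \<le> cnt f x n" using kl by (auto simp: y'_def)
    have 1: "(k + l) mod 2 ^ w = k + l" "Suc (k + l) mod 2 ^ w = Suc (k + l)" "Suc 0 mod 2 ^ w = Suc 0"
      "2 mod 2 ^ w = (2::nat)" "(?H + y') mod 2 ^ w = ?H + y'"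
      using kl cn M H y' \<open>w \<noteq> 0\<close> by auto
    have d: "y' - 1 - k \<le> (l - k) div 2" "l - y' \<le> (l - k) div 2" using kl by (auto simp: y'_def)
    show "wp w search_step
      (\<lambda>t s'. I s' \<and> floorlog 2 (reg s' ''l'' - reg s' ''k'') < floorlog 2 (reg s1 ''l'' - reg s1 ''k'') \<and>
         t + cond_cost (Less (Reg ''k'') (Reg ''l'')) + 1 \<le> 30) s1"
    proof (cases "cnt f x q < y'")
      case True
      then have "I (s\<lparr>reg := (reg s)(''h'' := ?H, ''k'' := k, ''l'' := y' - 1, ''y'' := y')\<rparr>)"
        unfolding I_def using kl y'
        by (intro exI[of _ k] exI[of _ "y' - 1"] exI[of _ y']) auto
      then show ?thesis
        using s1 1 cmp[OF y'(3,4)] True q d floorlog_half[of "l - k"] kl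
        by (simp add: search_step_def fun_upd_twist y'_def[symmetric] \<open>w \<noteq> 0\<close>)
    next
      case False
      then have "I (s\<lparr>reg := (reg s)(''h'' := ?H, ''k'' := y', ''l'' := l, ''y'' := y')\<rparr>)"
        unfolding I_def using kl y'
        by (intro exI[of _ y'] exI[of _ l] exI[of _ y']) auto
      then show ?thesis
        using s1 1 cmp[OF y'(3,4)] False q d floorlog_half[of "l - k"] kl
        by (simp add: search_step_def fun_upd_twist y'_def[symmetric] \<open>w \<noteq> 0\<close>)
    qed
  next
    fix t s' assume "I s'" and c: "\<not> cond_val w (Less (Reg ''k'') (Reg ''l'')) s'"
      and t: "t \<le> 30 * floorlog 2 (reg ?s0 ''l'' - reg ?s0 ''k'') + cond_cost (Less (Reg ''k'') (Reg ''l'')) + 1"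
    then obtain k l y where s': "s' = s\<lparr>reg := (reg s)(''h'' := ?H, ''k'' := k, ''l'' := l, ''y'' := y)\<rparr>"
      and kl: "k \<le> cnt f x q" "cnt f x q \<le> l" "\<not> k < l"
      unfolding I_def by auto
    then have "k = cnt f x q" by simp
    then show "t \<le> 30 * floorlog 2 n + 10 \<and>
      (\<exists>l y. s' = s\<lparr>reg := (reg s)(''h'' := ?H, ''k'' := cnt f x q, ''l'' := l, ''y'' := y)\<rparr>)"
      using t floorlog_mono[OF cn, of 2] s' by auto
  qed
  show ?thesis
    using C \<open>w \<noteq> 0\<close>
    by (simp add: search_def x(1)[symmetric], rule_tac wp_mono[OF loop[unfolded x(1)[symmetric]]],
        elim conjE exE, hypsubst, rule_tac Q, simp)
qed

text \<open>Translates the result of the search. Entry \<open>cnt f x q\<close> belongs to the last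
  \<open>x\<close> before \<open>q\<close>, or is \<open>0\<close> if there is none, so one strict
  comparison with \<open>a\<close> decides whether the window contains \<open>x\<close>. The
  following entry belongs to the first \<open>x\<close> from \<open>q\<close> on.\<close>

lemma occ_table:
  assumes st: "static f n e p R A" and x: "0 < cnt f x n" and q: "q \<le> n"
  shows "A ''OCC'' (A ''BASE'' x + cnt f x q) \<le> n"
    and "a < A ''OCC'' (A ''BASE'' x + cnt f x q) \<longleftrightarrow> x \<in> set (seg f a q)"
    and "a < A ''OCC'' (A ''BASE'' x + cnt f x q) \<Longrightarrow>
      \<exists>i. A ''OCC'' (A ''BASE'' x + cnt f x q) = Suc i \<and> a \<le> i \<and> i < q \<and> f i = x \<and> (\<forall>j. i < j \<longrightarrow> j < q \<longrightarrow> f j \<noteq> x)"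
    and "cnt f x q < cnt f x n \<Longrightarrow>
      \<exists>i<n. A ''OCC'' (A ''BASE'' x + cnt f x q + 1) = Suc i \<and> q \<le> i \<and> f i = x \<and> (\<forall>j. q \<le> j \<longrightarrow> j < i \<longrightarrow> f j \<noteq> x)"
proof -
  have O: "\<And>k. k < cnt f x n \<Longrightarrow> \<exists>i<n. f i = x \<and> cnt f x i = k \<and> A ''OCC'' (A ''BASE'' x + k + 1) = i + 1"
    and O0: "A ''OCC'' (A ''BASE'' x) = 0"
    using st x unfolding static_def by blast+
  let ?o = "A ''OCC'' (A ''BASE'' x + cnt f x q)"
  have main: "?o \<le> n \<and> (a < ?o \<longleftrightarrow> x \<in> set (seg f a q)) \<and> (a < ?o \<longrightarrow>
    (\<exists>i. ?o = Suc i \<and> a \<le> i \<and> i < q \<and> f i = x \<and> (\<forall>j. i < j \<longrightarrow> j < q \<longrightarrow> f j \<noteq> x)))"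
  proof (cases "cnt f x q")
    case 0
    have "x \<notin> set (seg f a q)" using cnt_less[of f _ x q] 0 by (fastforce simp: in_set_seg)
    then show ?thesis using 0 O0 by simp
  next
    case (Suc k)
    then have "k < cnt f x n" using q cnt_mono[of q n f x] by simp
    then obtain i where i: "i < n" "f i = x" "cnt f x i = k" "A ''OCC'' (A ''BASE'' x + k + 1) = i + 1"
      using O by blast
    note last = last_occurrence[OF i(2,3) Suc]
    have "x \<in> set (seg f a q) \<longleftrightarrow> a \<le> i"
    proof
      assume "x \<in> set (seg f a q)"
      then obtain j where j: "a \<le> j" "j < q" "f j = x" by (auto simp: in_set_seg)
      then have "\<not> i < j" using last(2) by blast
      then show "a \<le> i" using j by simp
    next
      assume "a \<le> i"
      then show "x \<in> set (seg f a q)" using i last(1) by (auto simp: in_set_seg)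
    qed
    then show ?thesis using i last Suc by auto
  qed
  then show "?o \<le> n" "a < ?o \<longleftrightarrow> x \<in> set (seg f a q)"
    "a < ?o \<Longrightarrow> \<exists>i. ?o = Suc i \<and> a \<le> i \<and> i < q \<and> f i = x \<and> (\<forall>j. i < j \<longrightarrow> j < q \<longrightarrow> f j \<noteq> x)"
    by blast+
  assume "cnt f x q < cnt f x n"
  then obtain i where i: "i < n" "f i = x" "cnt f x i = cnt f x q" "A ''OCC'' (A ''BASE'' x + cnt f x q + 1) = i + 1"
    using O by blast
  show "\<exists>i<n. A ''OCC'' (A ''BASE'' x + cnt f x q + 1) = Suc i \<and> q \<le> i \<and> f i = x \<and> (\<forall>j. q \<le> j \<longrightarrow> j < i \<longrightarrow> f j \<noteq> x)"
    using i next_occurrence[OF i(2,3)] by (intro exI[of _ i]) auto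
qed

lemma square_bound: "(n + 2)\<^sup>2 \<le> M \<Longrightarrow> n * n + 4 * n + 4 \<le> M" for n :: nat
  by (simp add: power2_eq_square algebra_simps)

lemma base_bound: "static f n e p R A \<Longrightarrow> 0 < cnt f x n \<Longrightarrow> A ''BASE'' x + n < (n + 2)\<^sup>2"
  by (simp add: static_def)

text \<open>
  Registers: \<open>t\<close> is the stack pointer, \<open>u\<close> the length of the output in array \<open>B\<close>, \<open>g\<close> tells whether a
  letter was pushed, and \<open>z\<close> is \<open>0\<close> once the loop is to stop. The tables store successors of positions.
\<close>

definition push :: com where
  "push = block
    [Assign ''q'' (Load ''QA'' (Reg ''t'')), search, Assign ''v'' (Load ''OCC'' (add (Reg ''h'') (Reg ''k''))),
     Assign ''q'' (Load ''QB'' (Reg ''t'')), search, Assign ''r'' (Load ''OCC'' (add (Reg ''h'') (Reg ''k''))),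
     Ite (Conj (Less (Reg ''a'') (Reg ''v'')) (Less (Reg ''b'') (Reg ''r'')))
       (block
         [Assign ''t'' (add (Reg ''t'') (Const 1)),
          Store ''V'' (Reg ''t'') (Reg ''x''),
          Store ''QA'' (Reg ''t'') (sub (Reg ''v'') (Const 1)),
          Store ''QB'' (Reg ''t'') (sub (Reg ''r'') (Const 1)),
          Assign ''g'' (Const 1)])
       (Assign ''g'' (Const 0))]"

abbreviation push_regs :: "string set" where
  "push_regs \<equiv> {''q'', ''h'', ''k'', ''l'', ''y'', ''v'', ''r'', ''t'', ''g''}"

lemma wp_push:
  assumes st: "static f n e p (reg s) (arr s)" and w: "(n + 2)\<^sup>2 \<le> 2 ^ w"
    and x: "x = reg s ''x''" "0 < cnt f x n"
    and t: "t = reg s ''t''" "t \<le> n" and q: "arr s ''QA'' t \<le> n" "arr s ''QB'' t \<le> n"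
    and succ: "\<And>c s' i j. c \<le> 200 * (floorlog 2 n + 1) \<Longrightarrow>
      static f n e p (reg s') (arr s') \<Longrightarrow> \<forall>y. y \<notin> push_regs \<longrightarrow> reg s' y = reg s y \<Longrightarrow>
      reg s' ''t'' = Suc t \<Longrightarrow> reg s' ''g'' = 1 \<Longrightarrow>
      arr s' = (arr s)(''V'' := (arr s ''V'')(Suc t := x), ''QA'' := (arr s ''QA'')(Suc t := i),
        ''QB'' := (arr s ''QB'')(Suc t := j)) \<Longrightarrow>
      reg s ''a'' \<le> i \<Longrightarrow> i < arr s ''QA'' t \<Longrightarrow> f i = x \<Longrightarrow> (\<And>k. i < k \<Longrightarrow> k < arr s ''QA'' t \<Longrightarrow> f k \<noteq> x) \<Longrightarrow>
      reg s ''b'' \<le> j \<Longrightarrow> j < arr s ''QB'' t \<Longrightarrow> f j = x \<Longrightarrow> (\<And>k. j < k \<Longrightarrow> k < arr s ''QB'' t \<Longrightarrow> f k \<noteq> x) \<Longrightarrow>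
      Q c s'"
    and fail: "\<And>c s'. c \<le> 200 * (floorlog 2 n + 1) \<Longrightarrow>
      static f n e p (reg s') (arr s') \<Longrightarrow> \<forall>y. y \<notin> push_regs \<longrightarrow> reg s' y = reg s y \<Longrightarrow>
      reg s' ''t'' = t \<Longrightarrow> reg s' ''g'' = 0 \<Longrightarrow> arr s' = arr s \<Longrightarrow>
      x \<notin> set (seg f (reg s ''a'') (arr s ''QA'' t)) \<or> x \<notin> set (seg f (reg s ''b'') (arr s ''QB'' t)) \<Longrightarrow>
      Q c s'"
  shows "wp w push Q s"
proof -
  have M: "n * n + 4 * n + 4 \<le> 2 ^ w" using w by (rule square_bound)
  then have "w \<noteq> 0" by (intro notI) simp
  let ?qa = "arr s ''QA'' t" and ?qb = "arr s ''QB'' t"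
  let ?v = "arr s ''OCC'' (arr s ''BASE'' x + cnt f x ?qa)" and ?r = "arr s ''OCC'' (arr s ''BASE'' x + cnt f x ?qb)"
  have "arr s ''BASE'' x + n < 2 ^ w" using base_bound[OF st x(2)] w by (rule less_le_trans)
  then have m: "(arr s ''BASE'' x + cnt f x ?qa) mod 2 ^ w = arr s ''BASE'' x + cnt f x ?qa"
    "(arr s ''BASE'' x + cnt f x ?qb) mod 2 ^ w = arr s ''BASE'' x + cnt f x ?qb"
    using cnt_le[of f x ?qa] cnt_le[of f x ?qb] q by auto
  have t1: "Suc t mod 2 ^ w = Suc t" "Suc 0 mod 2 ^ w = Suc 0" using t(2) M \<open>w \<noteq> 0\<close> by auto
  note A = occ_table[OF st x(2) q(1)] and B = occ_table[OF st x(2) q(2)]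
  show ?thesis
    unfolding push_def
    apply (simp add: t(1)[symmetric])
    apply (rule wp_search[where x = x and q = ?qa and n = n and f = f and e = e and p = p])
          apply (use st w x q in simp_all)[6]
    apply (simp add: t(1)[symmetric] m)
    apply (rule wp_search[where x = x and q = ?qb and n = n and f = f and e = e and p = p])
          apply (use st w x q in simp_all)[6]
    apply (simp add: t(1)[symmetric] m t1 \<open>w \<noteq> 0\<close>)
    apply (intro conjI impI)
    subgoal premises prems for c1 c2 l y
    proof -
      obtain i where i: "?v = Suc i" "reg s ''a'' \<le> i" "i < ?qa" "f i = x" "\<forall>j. i < j \<longrightarrow> j < ?qa \<longrightarrow> f j \<noteq> x"
        using A(3)[of "reg s ''a''"] prems by blast
      obtain j where j: "?r = Suc j" "reg s ''b'' \<le> j" "j < ?qb" "f j = x" "\<forall>k. j < k \<longrightarrow> k < ?qb \<longrightarrow> f k \<noteq> x"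
        using B(3)[of "reg s ''b''"] prems by blast
      show ?thesis
        by (rule succ[of _ _ i j]) (use prems st t1 i j x t in \<open>auto simp: fun_eq_iff\<close>)
    qed
    subgoal premises prems for c1 c2 l y
      by (rule fail) (use prems st A(2)[of "reg s ''a''"] B(2)[of "reg s ''b''"] x t in auto)
    done
qed

section \<open>The extension loop\<close>

text \<open>The loaded entries are successors of positions, hence already the new window starts just
  behind the letter.\<close>

definition advance :: com where
  "advance = block
    [Assign ''q'' (Reg ''a''), search, Assign ''a'' (Load ''OCC'' (add (add (Reg ''h'') (Reg ''k'')) (Const 1))),
     Assign ''q'' (Reg ''b''), search, Assign ''b'' (Load ''OCC'' (add (add (Reg ''h'') (Reg ''k'')) (Const 1)))]"

abbreviation advance_regs :: "string set" where
  "advance_regs \<equiv> {''q'', ''h'', ''k'', ''l'', ''y'', ''a'', ''b''}"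

lemma wp_advance:
  assumes st: "static f n e p (reg s) (arr s)" and w: "(n + 2)\<^sup>2 \<le> 2 ^ w"
    and x: "x = reg s ''x''" and a: "a = reg s ''a''" "a \<le> n" "cnt f x a < cnt f x n"
    and b: "b = reg s ''b''" "b \<le> n" "cnt f x b < cnt f x n"
    and Q: "\<And>c s' i j. c \<le> 200 * (floorlog 2 n + 1) \<Longrightarrow>
      static f n e p (reg s') (arr s') \<Longrightarrow> \<forall>y. y \<notin> advance_regs \<longrightarrow> reg s' y = reg s y \<Longrightarrow> arr s' = arr s \<Longrightarrow>
      reg s' ''a'' = Suc i \<Longrightarrow> reg s' ''b'' = Suc j \<Longrightarrow>
      a \<le> i \<Longrightarrow> f i = x \<Longrightarrow> (\<And>k. a \<le> k \<Longrightarrow> k < i \<Longrightarrow> f k \<noteq> x) \<Longrightarrow>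
      b \<le> j \<Longrightarrow> f j = x \<Longrightarrow> (\<And>k. b \<le> k \<Longrightarrow> k < j \<Longrightarrow> f k \<noteq> x) \<Longrightarrow> Q c s'"
  shows "wp w advance Q s"
proof -
  have M: "n * n + 4 * n + 4 \<le> 2 ^ w" using w by (rule square_bound)
  then have "w \<noteq> 0" by (intro notI) simp
  have x0: "0 < cnt f x n" using a(3) by simp
  have "arr s ''BASE'' x + n < 2 ^ w" using base_bound[OF st x0] w by (rule less_le_trans)
  then have m: "(arr s ''BASE'' x + cnt f x a) mod 2 ^ w = arr s ''BASE'' x + cnt f x a"
    "Suc (arr s ''BASE'' x + cnt f x a) mod 2 ^ w = Suc (arr s ''BASE'' x + cnt f x a)"
    "(arr s ''BASE'' x + cnt f x b) mod 2 ^ w = arr s ''BASE'' x + cnt f x b"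
    "Suc (arr s ''BASE'' x + cnt f x b) mod 2 ^ w = Suc (arr s ''BASE'' x + cnt f x b)"
    using cnt_le[of f x n] a(3) b(3) by auto
  note A = occ_table(4)[OF st x0 a(2,3)] and B = occ_table(4)[OF st x0 b(2,3)]
  show ?thesis
    unfolding advance_def
    apply (simp add: a(1)[symmetric])
    apply (rule wp_search[where x = x and q = a and n = n and f = f and e = e and p = p])
          apply (use st w x x0 a in simp_all)[6]
    apply (simp add: b(1)[symmetric] m \<open>w \<noteq> 0\<close>)
    apply (rule wp_search[where x = x and q = b and n = n and f = f and e = e and p = p])
          apply (use st w x x0 b in simp_all)[6]
    apply (simp add: m \<open>w \<noteq> 0\<close>)
    subgoal premises prems for c1 c2 l y
    proof -
      obtain i where i: "arr s ''OCC'' (arr s ''BASE'' x + cnt f x a + 1) = Suc i" "a \<le> i" "f i = x"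
          "\<forall>j. a \<le> j \<longrightarrow> j < i \<longrightarrow> f j \<noteq> x"
        using A by blast
      obtain j where j: "arr s ''OCC'' (arr s ''BASE'' x + cnt f x b + 1) = Suc j" "b \<le> j" "f j = x"
          "\<forall>k. b \<le> k \<longrightarrow> k < j \<longrightarrow> f k \<noteq> x"
        using B by blast
      show ?thesis
        by (rule Q[of _ _ i j]) (use prems st i j x in auto)
    qed
    done
qed

text \<open>After a successful push \<open>d\<close> stays, since the letter just tested may occur
  in the shortened windows again.\<close>

definition try_push :: com where
  "try_push = block [push, Ite (Equal (Reg ''g'') (Const 0)) (Assign ''d'' (add (Reg ''d'') (Const 1))) Skip]"

definition advance_reset :: com where
  "advance_reset = block [advance, Assign ''d'' (Const 0)]"

definition window :: cond where
  "window = Conj (Less (add (Reg ''a'') (half (Reg ''d''))) (Load ''QA'' (Reg ''t'')))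
    (Less (add (Reg ''b'') (half (Reg ''d''))) (Load ''QB'' (Reg ''t'')))"

lemma cost_window [simp]: "cond_cost window = 17"
  by (simp add: window_def)

definition mcs_step :: com where
  "mcs_step =
    Ite window
      (block
        [Ite (Equal (Op Mod (Reg ''d'') (Const 2)) (Const 0))
          (Assign ''x'' (Load ''S'' (add (Reg ''a'') (half (Reg ''d'')))))
          (Assign ''x'' (Load ''S'' (add (Reg ''b'') (half (Reg ''d''))))),
         try_push])
      (Ite (Equal (Reg ''t'') (Const 0))
        (Assign ''z'' (Const 0))
        (block
          [Assign ''x'' (Load ''V'' (Reg ''t'')),
           Assign ''t'' (sub (Reg ''t'') (Const 1)),
           Store ''B'' (Reg ''u'') (Reg ''x''),
           Assign ''u'' (add (Reg ''u'') (Const 1)),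
           advance_reset]))"

definition mcs_loop :: com where
  "mcs_loop = While (Less (Const 0) (Reg ''z'')) mcs_step"

text \<open>The new output starts at cell \<open>m\<close> of array \<open>B\<close>; the cells
  before it hold a finished prefix that must stay intact. \<open>W\<close> is the word that the
  result has to contain.\<close>

definition loop_inv :: "(nat \<Rightarrow> nat) \<Rightarrow> nat \<Rightarrow> nat \<Rightarrow> nat \<Rightarrow> nat \<Rightarrow> nat \<Rightarrow> nat \<Rightarrow> nat \<Rightarrow> nat \<Rightarrow>
    (nat \<Rightarrow> nat) \<Rightarrow> nat list \<Rightarrow> state \<Rightarrow> bool" where
  "loop_inv f n e p l1 h1 l2 h2 m B W s \<longleftrightarrow>
     static f n e p (reg s) (arr s) \<and> m \<le> reg s ''u'' \<and>
     mcs_inv f l1 h1 l2 h2 (seg (arr s ''B'') m (reg s ''u'')) (reg s ''a'') (reg s ''b'') (reg s ''t'')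
       (arr s ''V'') (arr s ''QA'') (arr s ''QB'') (reg s ''d'') \<and>
     subseq W (seg (arr s ''B'') m (reg s ''u'') @ stk (arr s ''V'') (reg s ''t'')) \<and>
     (\<forall>i<m. arr s ''B'' i = B i) \<and> reg s ''z'' \<le> 1 \<and>
     (reg s ''z'' = 0 \<longrightarrow> reg s ''t'' = 0 \<and> maximal_common f l1 h1 l2 h2 (seg (arr s ''B'') m (reg s ''u'')))"

lemma mcs_inv_bounds:
  assumes "mcs_inv f l1 h1 l2 h2 U a b sp V QA QB d"
  shows "length U + sp \<le> h1 - l1" "a + d div 2 \<le> QA sp" "QA sp \<le> h1" "b + d div 2 \<le> QB sp" "QB sp \<le> h2"
proof -
  show "length U + sp \<le> h1 - l1"
    using mcs_inv_common[OF assms] list_emb_length[of "(=)" "U @ stk V sp" "seg f l1 h1"] by (simp add: common_def)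
  show "a + d div 2 \<le> QA sp" "b + d div 2 \<le> QB sp" "QA sp \<le> h1" "QB sp \<le> h2"
    using assms by (auto simp: mcs_inv_def Rres_def)
qed

text \<open>Ensures that \<open>advance\<close> reads existing entries: the top letter of the stack
  still occurs behind both window starts.\<close>

lemma mcs_inv_top:
  assumes "mcs_inv f l1 h1 l2 h2 U a b (Suc sp) V QA QB d"
  shows "cnt f (V (Suc sp)) a < cnt f (V (Suc sp)) h1" "cnt f (V (Suc sp)) b < cnt f (V (Suc sp)) h2"
proof -
  have *: "cnt f x a < cnt f x h" if "Lres f l h U a" "subseq (U @ x # W) (seg f l h)" for x W l h a
  proof -
    have "subseq (x # W) (seg f a h)" using that Lres_iff by blast
    then have "x \<in> set (seg f a h)" using subseq_setD by fastforce
    then obtain i where i: "a \<le> i" "i < h" "f i = x" by (auto simp: in_set_seg)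
    then show ?thesis using cnt_less[of f i x h] cnt_mono[of a i f x] by simp
  qed
  have "common f l1 h1 l2 h2 (U @ V (Suc sp) # stk V sp)"
    using mcs_inv_common[OF assms] by simp
  then show "cnt f (V (Suc sp)) a < cnt f (V (Suc sp)) h1" "cnt f (V (Suc sp)) b < cnt f (V (Suc sp)) h2"
    using * assms unfolding common_def mcs_inv_def by blast+
qed

text \<open>A failed test raises \<open>d\<close>. A push raises \<open>t\<close>, and
  \<open>u + t - m\<close> is the length of the common subsequence, at most \<open>l\<close>. A pop
  keeps \<open>u + t\<close> and resets \<open>d\<close>, but moves \<open>a\<close> and
  \<open>b\<close> far enough. Stopping clears \<open>z\<close>.\<close>

definition potential :: "nat \<Rightarrow> nat \<Rightarrow> nat \<Rightarrow> nat \<Rightarrow> state \<Rightarrow> nat" where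
  "potential h1 h2 l m s = (2 * (h1 - reg s ''a'') + 2 * (h2 - reg s ''b'') + 1 - reg s ''d'') +
     (l + m - (reg s ''u'' + reg s ''t'')) + reg s ''z''"

text \<open>The weight 2 is needed because the jump is only known to cover \<open>d div 2\<close>.
  Stepping behind the two occurrences supplies the rest.\<close>

lemma potential_pop:
  fixes a b d i j h h' :: nat
  assumes "a \<le> i" "b \<le> j" "i < h" "j < h'" "a + b + d div 2 \<le> i + j"
  shows "2 * (h - Suc i) + 2 * (h' - Suc j) + 1 < 2 * (h - a) + 2 * (h' - b) + 1 - d"
proof -
  obtain k l x y where "i = a + k" "j = b + l" "h = Suc i + x" "h' = Suc j + y"
    using assms by (metis less_iff_Suc_add add_Suc le_iff_add)
  then show ?thesis using assms(5) by simp
qed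

lemma mcs_step_correct:
  assumes I: "loop_inv f n e p l1 h1 l2 h2 m B W s" and z: "reg s ''z'' \<noteq> 0"
    and w: "(n + 2)\<^sup>2 \<le> 2 ^ w" and h: "h1 \<le> n" "h2 \<le> n" "m \<le> n"
  shows "wp w mcs_step (\<lambda>c s'. loop_inv f n e p l1 h1 l2 h2 m B W s' \<and>
    potential h1 h2 (h1 - l1) m s' < potential h1 h2 (h1 - l1) m s \<and> c + 4 \<le> 300 * (floorlog 2 n + 1)) s"
proof -
  have M: "n * n + 4 * n + 4 \<le> 2 ^ w" using w by (rule square_bound)
  then have "w \<noteq> 0" by (intro notI) simp
  then have "2 mod 2 ^ w = (2::nat)" using M by simp
  let ?U = "seg (arr s ''B'') m (reg s ''u'')"
  define a b d t u where regs: "a = reg s ''a''" "b = reg s ''b''" "d = reg s ''d''" "t = reg s ''t''" "u = reg s ''u''"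
  have st: "static f n e p (reg s) (arr s)" and mu: "m \<le> u" and z1: "reg s ''z'' = 1"
    and B: "\<forall>i<m. arr s ''B'' i = B i" and W: "subseq W (?U @ stk (arr s ''V'') t)"
    and inv: "mcs_inv f l1 h1 l2 h2 ?U a b t (arr s ''V'') (arr s ''QA'') (arr s ''QB'') d"
    using I z by (auto simp: loop_inv_def regs)
  note bd = mcs_inv_bounds[OF inv, unfolded length_seg, folded regs]
  let ?qa = "arr s ''QA'' t" and ?qb = "arr s ''QB'' t"
  have small: "(a + d div 2) mod 2 ^ w = a + d div 2" "(b + d div 2) mod 2 ^ w = b + d div 2"
    "Suc d mod 2 ^ w = Suc d" "Suc u mod 2 ^ w = Suc u" "2 mod 2 ^ w = (2::nat)" "Suc 0 mod 2 ^ w = Suc 0"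
    using bd h mu M \<open>w \<noteq> 0\<close> by auto
  have S: "arr s ''S'' = f" using st by (simp add: static_def)
  have win: "cond_val w window s \<longleftrightarrow> a + d div 2 < ?qa \<and> b + d div 2 < ?qb"
    using small by (simp add: window_def regs)
  show ?thesis
  proof (cases "a + d div 2 < ?qa \<and> b + d div 2 < ?qb")
    case True
    define x where "x = (if even d then f (a + d div 2) else f (b + d div 2))"
    have x0: "0 < cnt f x n"
      using True bd h cnt_pos[of "a + d div 2" n f] cnt_pos[of "b + d div 2" n f] by (auto simp: x_def)
    have "wp w try_push
      (\<lambda>c s'. loop_inv f n e p l1 h1 l2 h2 m B W s' \<and> potential h1 h2 (h1 - l1) m s' < potential h1 h2 (h1 - l1) m s \<and>
        c + 50 \<le> 300 * (floorlog 2 n + 1)) (s\<lparr>reg := (reg s)(''x'' := x)\<rparr>)"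
      (is "wp w _ ?Q _")
    proof (unfold try_push_def block.simps wp_Seq, rule wp_push[where x = x and t = t and f = f and n = n and e = e and p = p])
      fix c :: nat and s' :: state and i j :: nat
      assume s': "c \<le> 200 * (floorlog 2 n + 1)" "static f n e p (reg s') (arr s')"
        and fr: "\<forall>y. y \<notin> push_regs \<longrightarrow> reg s' y = reg (s\<lparr>reg := (reg s)(''x'' := x)\<rparr>) y"
        and tg: "reg s' ''t'' = Suc t" "reg s' ''g'' = 1"
        and ar: "arr s' = (arr (s\<lparr>reg := (reg s)(''x'' := x)\<rparr>))
          (''V'' := (arr (s\<lparr>reg := (reg s)(''x'' := x)\<rparr>) ''V'')(Suc t := x),
           ''QA'' := (arr (s\<lparr>reg := (reg s)(''x'' := x)\<rparr>) ''QA'')(Suc t := i),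
           ''QB'' := (arr (s\<lparr>reg := (reg s)(''x'' := x)\<rparr>) ''QB'')(Suc t := j))"
        and i: "reg (s\<lparr>reg := (reg s)(''x'' := x)\<rparr>) ''a'' \<le> i" "i < arr (s\<lparr>reg := (reg s)(''x'' := x)\<rparr>) ''QA'' t" "f i = x"
          "\<And>k. i < k \<Longrightarrow> k < arr (s\<lparr>reg := (reg s)(''x'' := x)\<rparr>) ''QA'' t \<Longrightarrow> f k \<noteq> x"
        and j: "reg (s\<lparr>reg := (reg s)(''x'' := x)\<rparr>) ''b'' \<le> j" "j < arr (s\<lparr>reg := (reg s)(''x'' := x)\<rparr>) ''QB'' t" "f j = x"
          "\<And>k. j < k \<Longrightarrow> k < arr (s\<lparr>reg := (reg s)(''x'' := x)\<rparr>) ''QB'' t \<Longrightarrow> f k \<noteq> x"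
      have r: "reg s' ''a'' = a" "reg s' ''b'' = b" "reg s' ''d'' = d" "reg s' ''u'' = u" "reg s' ''z'' = 1"
        using fr z1 by (simp_all add: regs)
      have "mcs_inv f l1 h1 l2 h2 ?U a b (Suc t) ((arr s ''V'')(Suc t := x)) ((arr s ''QA'')(Suc t := i))
          ((arr s ''QB'')(Suc t := j)) d"
        by (rule mcs_inv_push[OF inv]) (use i j in \<open>simp_all add: regs\<close>)
      moreover have "subseq W (?U @ stk ((arr s ''V'')(Suc t := x)) (Suc t))"
      proof -
        have "subseq (?U @ stk (arr s ''V'') t) (?U @ stk ((arr s ''V'')(Suc t := x)) (Suc t))"
          by (simp add: subseq_append' list_emb_append2[of _ _ _ "[x]", simplified])
        then show ?thesis using W subseq_order.order_trans by blast
      qed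
      ultimately have I': "loop_inv f n e p l1 h1 l2 h2 m B W s'"
        using s' r tg ar mu B by (simp add: loop_inv_def regs)
      have "length ?U + Suc t \<le> h1 - l1" using mcs_inv_bounds(1)[OF \<open>mcs_inv _ _ _ _ _ _ _ _ (Suc t) _ _ _ _\<close>] by simp
      then have "h1 - l1 + m - (u + Suc t) < h1 - l1 + m - (u + t)"
        using mu unfolding length_seg regs by linarith
      then have "potential h1 h2 (h1 - l1) m s' < potential h1 h2 (h1 - l1) m s"
        unfolding potential_def r tg(1) z1 regs[symmetric] by linarith
      then show "wp w (Ite (Equal (Reg ''g'') (Const 0)) (Assign ''d'' (add (Reg ''d'') (Const 1))) Skip)
         (\<lambda>t2. ?Q (c + t2)) s'"
        using I' tg s'(1) by simp
    next
      fix c :: nat and s' :: state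
      assume s': "c \<le> 200 * (floorlog 2 n + 1)" "static f n e p (reg s') (arr s')"
        and fr: "\<forall>y. y \<notin> push_regs \<longrightarrow> reg s' y = reg (s\<lparr>reg := (reg s)(''x'' := x)\<rparr>) y"
        and tg: "reg s' ''t'' = t" "reg s' ''g'' = 0"
        and ar: "arr s' = arr (s\<lparr>reg := (reg s)(''x'' := x)\<rparr>)"
        and no: "x \<notin> set (seg f (reg (s\<lparr>reg := (reg s)(''x'' := x)\<rparr>) ''a'') (arr (s\<lparr>reg := (reg s)(''x'' := x)\<rparr>) ''QA'' t)) \<or>
          x \<notin> set (seg f (reg (s\<lparr>reg := (reg s)(''x'' := x)\<rparr>) ''b'') (arr (s\<lparr>reg := (reg s)(''x'' := x)\<rparr>) ''QB'' t))"
      have r: "reg s' ''a'' = a" "reg s' ''b'' = b" "reg s' ''d'' = d" "reg s' ''u'' = u" "reg s' ''z'' = 1"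
        using fr z1 by (simp_all add: regs)
      let ?s = "s'\<lparr>reg := (reg s')(''d'' := Suc d)\<rparr>"
      have "mcs_inv f l1 h1 l2 h2 ?U a b t (arr s ''V'') (arr s ''QA'') (arr s ''QB'') (Suc d)"
        by (rule mcs_inv_advance[OF inv _ _ x_def]) (use True no in \<open>simp_all add: regs\<close>)
      then have I': "loop_inv f n e p l1 h1 l2 h2 m B W ?s"
        using s' r tg ar mu B W by (simp add: loop_inv_def regs)
      have "d < 2 * (h1 - a) + 1" using True bd by linarith
      then have "2 * (h1 - a) + 2 * (h2 - b) + 1 - Suc d < 2 * (h1 - a) + 2 * (h2 - b) + 1 - d"
        by (intro diff_less_mono2) simp_all
      moreover have "potential h1 h2 (h1 - l1) m ?s =
          (2 * (h1 - a) + 2 * (h2 - b) + 1 - Suc d) + (h1 - l1 + m - (u + t)) + 1"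
        using r tg by (simp add: potential_def)
      moreover have "potential h1 h2 (h1 - l1) m s =
          (2 * (h1 - a) + 2 * (h2 - b) + 1 - d) + (h1 - l1 + m - (u + t)) + 1"
        using z1 by (simp add: potential_def regs)
      ultimately have "potential h1 h2 (h1 - l1) m ?s < potential h1 h2 (h1 - l1) m s"
        by (simp only: add_less_cancel_right)
      then show "wp w (Ite (Equal (Reg ''g'') (Const 0)) (Assign ''d'' (add (Reg ''d'') (Const 1))) Skip)
         (\<lambda>t2. ?Q (c + t2)) s'"
        using I' tg s'(1) r small by simp
    qed (use st w x0 bd h in \<open>simp_all add: regs\<close>)
    \<comment> \<open>\<open>k\<close> stands for the fixed cost of the tests and assignments before
      \<open>try_push\<close>; the slack 50 covers it and the 4 units of the loop test.\<close>
    then have push: "wp w try_push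
      (\<lambda>c s'. loop_inv f n e p l1 h1 l2 h2 m B W s' \<and> potential h1 h2 (h1 - l1) m s' < potential h1 h2 (h1 - l1) m s \<and>
        k + c + 4 \<le> 300 * (floorlog 2 n + 1)) (s\<lparr>reg := (reg s)(''x'' := x)\<rparr>)" if "k \<le> 46" for k
      by (rule wp_mono) (use that in auto)
    have "d mod 2 = 0 \<longleftrightarrow> even d" by (simp add: even_iff_mod_2_eq_zero)
    moreover have x: "even d \<Longrightarrow> f (a + d div 2) = x" "odd d \<Longrightarrow> f (b + d div 2) = x"
      by (simp_all add: x_def)
    ultimately show ?thesis
      using True small S win
      by (simp add: mcs_step_def regs[symmetric]) (rule wp_mono[OF push[of 40]]; simp)
  next
    case False
    note ex = this
    have nwin: "\<not> cond_val w window s" using win ex by blast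
    show ?thesis
    proof (cases t)
      case 0
      have "maximal_common f l1 h1 l2 h2 ?U" using mcs_inv_maximal[of f l1 h1 l2 h2] inv ex 0 by blast
      then show ?thesis using I 0 small z1 nwin
        by (auto simp add: mcs_step_def regs[symmetric] loop_inv_def potential_def)
    next
      case (Suc t')
      let ?x = "arr s ''V'' t"
      let ?s = "s\<lparr>arr := (arr s)(''B'' := (arr s ''B'')(u := ?x)), reg := (reg s)(''x'' := ?x, ''t'' := t', ''u'' := Suc u)\<rparr>"
      have top: "cnt f ?x a < cnt f ?x n" "cnt f ?x b < cnt f ?x n"
        using mcs_inv_top[OF inv[unfolded Suc]] h cnt_mono[of h1 n f ?x] cnt_mono[of h2 n f ?x] Suc by auto
      have "wp w advance_reset
        (\<lambda>c s'. loop_inv f n e p l1 h1 l2 h2 m B W s' \<and> potential h1 h2 (h1 - l1) m s' < potential h1 h2 (h1 - l1) m s \<and>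
        c + 50 \<le> 300 * (floorlog 2 n + 1)) ?s"
        (is "wp w _ ?Q _")
      proof (unfold advance_reset_def block.simps wp_Seq, rule wp_advance[where x = ?x and a = a and b = b and f = f and n = n and e = e and p = p])
        fix c :: nat and s' :: state and i j :: nat
        assume s': "c \<le> 200 * (floorlog 2 n + 1)" "static f n e p (reg s') (arr s')"
          and fr: "\<forall>y. y \<notin> advance_regs \<longrightarrow> reg s' y = reg ?s y"
          and ar: "arr s' = arr ?s" and ij: "reg s' ''a'' = Suc i" "reg s' ''b'' = Suc j"
          and i: "a \<le> i" "f i = ?x" "\<And>k. a \<le> k \<Longrightarrow> k < i \<Longrightarrow> f k \<noteq> ?x"
          and j: "b \<le> j" "f j = ?x" "\<And>k. b \<le> k \<Longrightarrow> k < j \<Longrightarrow> f k \<noteq> ?x"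
        have r: "reg s' ''t'' = t'" "reg s' ''u'' = Suc u" "reg s' ''z'' = 1"
          using fr z1 by (simp_all add: regs)
        let ?s' = "s'\<lparr>reg := (reg s')(''d'' := 0)\<rparr>"
        have "?x = arr s ''V'' (Suc t')" using Suc by simp
        note pop = mcs_inv_pop[OF inv[unfolded Suc] ex[unfolded Suc] this i j]
        have U: "seg ((arr s ''B'')(u := ?x)) m (Suc u) = ?U @ [?x]"
          using mu seg_cong[of m u "(arr s ''B'')(u := ?x)" "arr s ''B''"] by (simp add: seg_snoc regs)
        have "subseq W (?U @ [?x] @ stk (arr s ''V'') t')" using W Suc by simp
        then have I': "loop_inv f n e p l1 h1 l2 h2 m B W ?s'"
          using s' r ij ar mu B pop(1) U z1 by (simp add: loop_inv_def regs)
        have "2 * (h1 - Suc i) + 2 * (h2 - Suc j) + 1 < 2 * (h1 - a) + 2 * (h2 - b) + 1 - d"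
          using i(1) j(1) pop(3,4,2) by (rule potential_pop)
        moreover have "potential h1 h2 (h1 - l1) m ?s' =
            (2 * (h1 - Suc i) + 2 * (h2 - Suc j) + 1) + (h1 - l1 + m - (u + t)) + 1"
          using r ij Suc by (simp add: potential_def)
        moreover have "potential h1 h2 (h1 - l1) m s =
            (2 * (h1 - a) + 2 * (h2 - b) + 1 - d) + (h1 - l1 + m - (u + t)) + 1"
          using z1 by (simp add: potential_def regs)
        ultimately have "potential h1 h2 (h1 - l1) m ?s' < potential h1 h2 (h1 - l1) m s"
          by (simp only: add_less_cancel_right)
        then show "wp w (Assign ''d'' (Const 0)) (\<lambda>t2. ?Q (c + t2)) s'"
          using I' s'(1) r by simp
      qed (use st w top bd h in \<open>simp_all add: regs\<close>)
      then have adv: "wp w advance_reset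
        (\<lambda>c s'. loop_inv f n e p l1 h1 l2 h2 m B W s' \<and> potential h1 h2 (h1 - l1) m s' < potential h1 h2 (h1 - l1) m s \<and>
        k + c + 4 \<le> 300 * (floorlog 2 n + 1)) ?s" if "k \<le> 46" for k
        by (rule wp_mono) (use that in auto)
      moreover have "t \<noteq> 0" "t - Suc 0 = t'" using Suc by simp_all
      ultimately show ?thesis
        using small nwin
        by (simp add: mcs_step_def regs[symmetric]) (rule wp_mono[OF adv[of 40]]; simp)
    qed
  qed
qed

lemma mcs_loop_correct:
  assumes I: "loop_inv f n e p l1 h1 l2 h2 m B W s"
    and w: "(n + 2)\<^sup>2 \<le> 2 ^ w" and h: "h1 \<le> n" "h2 \<le> n" "m \<le> n"
    and Q: "\<And>c s'. c \<le> 300 * (floorlog 2 n + 1) * (5 * n + 2) + 10 \<Longrightarrow>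
      static f n e p (reg s') (arr s') \<Longrightarrow> m \<le> reg s' ''u'' \<Longrightarrow> reg s' ''u'' \<le> m + n \<Longrightarrow>
      Lres f l1 h1 (seg (arr s' ''B'') m (reg s' ''u'')) (reg s' ''a'') \<Longrightarrow>
      maximal_common f l1 h1 l2 h2 (seg (arr s' ''B'') m (reg s' ''u'')) \<Longrightarrow>
      subseq W (seg (arr s' ''B'') m (reg s' ''u'')) \<Longrightarrow> \<forall>i<m. arr s' ''B'' i = B i \<Longrightarrow> Q c s'"
  shows "wp w mcs_loop Q s"
  unfolding mcs_loop_def
proof (rule wp_While[where I = "loop_inv f n e p l1 h1 l2 h2 m B W" and
      \<Phi> = "potential h1 h2 (h1 - l1) m" and K = "300 * (floorlog 2 n + 1)"])
  show "loop_inv f n e p l1 h1 l2 h2 m B W s" by (rule I)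
next
  fix s assume I: "loop_inv f n e p l1 h1 l2 h2 m B W s" and "cond_val w (Less (Const 0) (Reg ''z'')) s"
  then have "reg s ''z'' \<noteq> 0" by simp
  from mcs_step_correct[OF I this w h]
  show "wp w mcs_step (\<lambda>c s'. loop_inv f n e p l1 h1 l2 h2 m B W s' \<and>
      potential h1 h2 (h1 - l1) m s' < potential h1 h2 (h1 - l1) m s \<and>
      c + cond_cost (Less (Const 0) (Reg ''z'')) + 1 \<le> 300 * (floorlog 2 n + 1)) s"
    by (rule wp_mono) simp
next
  fix c and s' :: state
  assume I': "loop_inv f n e p l1 h1 l2 h2 m B W s'" and z: "\<not> cond_val w (Less (Const 0) (Reg ''z'')) s'"
    and c: "c \<le> 300 * (floorlog 2 n + 1) * potential h1 h2 (h1 - l1) m s + cond_cost (Less (Const 0) (Reg ''z'')) + 1"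
  have "m \<le> reg s ''u''" "reg s ''z'' \<le> 1" using I by (auto simp: loop_inv_def)
  \<comment> \<open>At most \<open>4 * n + 1\<close> for scanning, \<open>n\<close> for pushes and 1
    for the final step.\<close>
  then have "potential h1 h2 (h1 - l1) m s \<le> (2 * n + 2 * n + 1) + n + 1"
    unfolding potential_def using h by (intro add_mono) auto
  then have "300 * (floorlog 2 n + 1) * potential h1 h2 (h1 - l1) m s \<le> 300 * (floorlog 2 n + 1) * (5 * n + 2)"
    by (intro mult_le_mono2) simp
  then have c': "c \<le> 300 * (floorlog 2 n + 1) * (5 * n + 2) + 10" using c by simp
  have inv: "mcs_inv f l1 h1 l2 h2 (seg (arr s' ''B'') m (reg s' ''u'')) (reg s' ''a'') (reg s' ''b'') (reg s' ''t'')
       (arr s' ''V'') (arr s' ''QA'') (arr s' ''QB'') (reg s' ''d'')"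
    using I' by (simp add: loop_inv_def)
  have t0: "reg s' ''t'' = 0" using I' z by (simp add: loop_inv_def)
  show "Q c s'"
  proof (rule Q[OF c'])
    show "subseq W (seg (arr s' ''B'') m (reg s' ''u''))" using I' by (simp add: loop_inv_def t0)
    show "reg s' ''u'' \<le> m + n" using mcs_inv_bounds(1)[OF inv] h by simp
    show "Lres f l1 h1 (seg (arr s' ''B'') m (reg s' ''u'')) (reg s' ''a'')"
      using inv by (simp add: mcs_inv_def)
  qed (use I' z in \<open>simp_all add: loop_inv_def\<close>)
qed

section \<open>Reloading a word and extending it at a new pair of segments\<close>

definition load_step :: com where
  "load_step = block
    [Assign ''x'' (Load ''B'' (sub (sub (Reg ''u'') (Const 1)) (Reg ''t''))),
     push,
     Assign ''z'' (Reg ''g'')]"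

definition load :: com where
  "load = While (Conj (Less (Reg ''t'') (Reg ''u'')) (Less (Const 0) (Reg ''z''))) load_step"

text \<open>Pushing the letters of \<open>B\<close> from the last to the first builds their
  rightmost embeddings. This is the invariant of the extension loop with empty \<open>U\<close>, so
  that loop can take over directly. A failed push shows that a suffix, and hence the whole word, is
  not common.\<close>

definition load_inv :: "(nat \<Rightarrow> nat) \<Rightarrow> nat \<Rightarrow> nat \<Rightarrow> nat \<Rightarrow> nat \<Rightarrow> nat \<Rightarrow> nat \<Rightarrow> nat \<Rightarrow> nat \<Rightarrow>
    (nat \<Rightarrow> nat) \<Rightarrow> state \<Rightarrow> bool" where
  "load_inv f n e p l1 h1 l2 h2 u B s \<longleftrightarrow>
     static f n e p (reg s) (arr s) \<and> reg s ''u'' = u \<and> reg s ''a'' = l1 \<and> reg s ''b'' = l2 \<and> reg s ''d'' = 0 \<and>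
     arr s ''B'' = B \<and> reg s ''t'' \<le> u \<and> reg s ''z'' \<le> 1 \<and>
     stk (arr s ''V'') (reg s ''t'') = seg B (u - reg s ''t'') u \<and>
     mcs_inv f l1 h1 l2 h2 [] l1 l2 (reg s ''t'') (arr s ''V'') (arr s ''QA'') (arr s ''QB'') 0 \<and>
     (reg s ''z'' = 0 \<longrightarrow> \<not> common f l1 h1 l2 h2 (seg B 0 u))"

lemma load_step_correct:
  assumes I: "load_inv f n e p l1 h1 l2 h2 u B s" and t: "reg s ''t'' < u" and z: "reg s ''z'' = 1"
    and w: "(n + 2)\<^sup>2 \<le> 2 ^ w" and h: "h1 \<le> n" "h2 \<le> n" "u \<le> n"
    and B: "\<forall>x\<in>set (seg B 0 u). 0 < cnt f x n"
  shows "wp w load_step (\<lambda>c s'. load_inv f n e p l1 h1 l2 h2 u B s' \<and>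
    (u - reg s' ''t'') + reg s' ''z'' < (u - reg s ''t'') + reg s ''z'' \<and> c + 10 \<le> 300 * (floorlog 2 n + 1)) s"
proof -
  have M: "n * n + 4 * n + 4 \<le> 2 ^ w" using w by (rule square_bound)
  then have "w \<noteq> 0" by (intro notI) simp
  define t where "t = reg s ''t''"
  define x where "x = B (u - Suc t)"
  let ?s = "s\<lparr>reg := (reg s)(''x'' := x)\<rparr>"
  have st: "static f n e p (reg s) (arr s)" and r: "reg s ''u'' = u" "reg s ''a'' = l1" "reg s ''b'' = l2" "reg s ''d'' = 0"
    and ar: "arr s ''B'' = B" and stk: "stk (arr s ''V'') t = seg B (u - t) u" and tu: "t < u" 
    and inv: "mcs_inv f l1 h1 l2 h2 [] l1 l2 t (arr s ''V'') (arr s ''QA'') (arr s ''QB'') 0"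
    using I t by (auto simp: load_inv_def t_def)
  have x: "0 < cnt f x n" using B tu by (auto simp: x_def set_seg)
  have seg: "seg B (u - Suc t) u = x # seg B (u - t) u"
    using seg_Cons[of "u - Suc t" u B] tu by (simp add: x_def Suc_diff_Suc)
  note bd = mcs_inv_bounds[OF inv]
  have push: "wp w push (\<lambda>c s'. let s'' = s'\<lparr>reg := (reg s')(''z'' := reg s' ''g'')\<rparr> in load_inv f n e p l1 h1 l2 h2 u B s'' \<and>
    (u - reg s'' ''t'') + reg s'' ''z'' < (u - t) + 1 \<and> c \<le> 200 * (floorlog 2 n + 1)) ?s"
  proof (rule wp_push[where x = x and t = t and f = f and n = n and e = e and p = p])
    fix c :: nat and s' :: state and i j :: nat
    assume s': "c \<le> 200 * (floorlog 2 n + 1)" "static f n e p (reg s') (arr s')"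
      and fr: "\<forall>y. y \<notin> push_regs \<longrightarrow> reg s' y = reg ?s y" and tg: "reg s' ''t'' = Suc t" "reg s' ''g'' = 1"
      and ar': "arr s' = (arr ?s)(''V'' := (arr ?s ''V'')(Suc t := x), ''QA'' := (arr ?s ''QA'')(Suc t := i),
           ''QB'' := (arr ?s ''QB'')(Suc t := j))"
      and i: "reg ?s ''a'' \<le> i" "i < arr ?s ''QA'' t" "f i = x" "\<And>k. i < k \<Longrightarrow> k < arr ?s ''QA'' t \<Longrightarrow> f k \<noteq> x"
      and j: "reg ?s ''b'' \<le> j" "j < arr ?s ''QB'' t" "f j = x" "\<And>k. j < k \<Longrightarrow> k < arr ?s ''QB'' t \<Longrightarrow> f k \<noteq> x"
    have r': "reg s' ''u'' = u" "reg s' ''a'' = l1" "reg s' ''b'' = l2" "reg s' ''d'' = 0"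
      using fr r by simp_all
    have "mcs_inv f l1 h1 l2 h2 [] l1 l2 (Suc t) ((arr s ''V'')(Suc t := x)) ((arr s ''QA'')(Suc t := i))
        ((arr s ''QB'')(Suc t := j)) 0"
      by (rule mcs_inv_push[OF inv]) (use i j r in simp_all)
    then show "let s'' = s'\<lparr>reg := (reg s')(''z'' := reg s' ''g'')\<rparr> in load_inv f n e p l1 h1 l2 h2 u B s'' \<and>
      (u - reg s'' ''t'') + reg s'' ''z'' < (u - t) + 1 \<and> c \<le> 200 * (floorlog 2 n + 1)"
      using s' r' tg ar' ar tu stk seg by (simp add: load_inv_def)
  next
    fix c :: nat and s' :: state
    assume s': "c \<le> 200 * (floorlog 2 n + 1)" "static f n e p (reg s') (arr s')"
      and fr: "\<forall>y. y \<notin> push_regs \<longrightarrow> reg s' y = reg ?s y" and tg: "reg s' ''t'' = t" "reg s' ''g'' = 0"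
      and ar': "arr s' = arr ?s"
      and no: "x \<notin> set (seg f (reg ?s ''a'') (arr ?s ''QA'' t)) \<or> x \<notin> set (seg f (reg ?s ''b'') (arr ?s ''QB'' t))"
    have r': "reg s' ''u'' = u" "reg s' ''a'' = l1" "reg s' ''b'' = l2" "reg s' ''d'' = 0"
      using fr r by simp_all
    have R: "Rres f l1 h1 (stk (arr s ''V'') t) (arr s ''QA'' t)" "Rres f l2 h2 (stk (arr s ''V'') t) (arr s ''QB'' t)"
      using inv by (simp_all add: mcs_inv_def)
    have no': "x \<notin> set (seg f l1 (arr s ''QA'' t)) \<or> x \<notin> set (seg f l2 (arr s ''QB'' t))"
      using no r by simp
    have "\<not> common f l1 h1 l2 h2 (seg B (u - Suc t) u)"
      using no' Rres_infeasible[OF R(1), of x] Rres_infeasible[OF R(2), of x] unfolding common_def seg stk by blast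
    then have "\<not> common f l1 h1 l2 h2 (seg B 0 u)"
      using common_subseq[of f l1 h1 l2 h2 "seg B 0 u", OF _ subseq_seg_mono[of 0 "u - Suc t" u u B]] by auto
    then show "let s'' = s'\<lparr>reg := (reg s')(''z'' := reg s' ''g'')\<rparr> in load_inv f n e p l1 h1 l2 h2 u B s'' \<and>
      (u - reg s'' ''t'') + reg s'' ''z'' < (u - t) + 1 \<and> c \<le> 200 * (floorlog 2 n + 1)"
      using s' r' tg ar' ar tu stk inv by (simp add: load_inv_def)
  qed (use st w x bd h tu in \<open>simp_all add: t_def\<close>)
  have "u - Suc t = u - Suc 0 - t" by simp
  then show ?thesis
    using r ar \<open>w \<noteq> 0\<close> z
    by (simp add: load_step_def t_def[symmetric] x_def[symmetric]) (rule wp_mono[OF push]; simp add: Let_def)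
qed

lemma load_correct:
  assumes I: "load_inv f n e p l1 h1 l2 h2 u B s"
    and w: "(n + 2)\<^sup>2 \<le> 2 ^ w" and h: "h1 \<le> n" "h2 \<le> n" "u \<le> n"
    and B: "\<forall>x\<in>set (seg B 0 u). 0 < cnt f x n"
    and Q: "\<And>c s'. c \<le> 300 * (floorlog 2 n + 1) * (n + 1) + 10 \<Longrightarrow> load_inv f n e p l1 h1 l2 h2 u B s' \<Longrightarrow>
      reg s' ''z'' = 0 \<or> reg s' ''t'' = u \<Longrightarrow> Q c s'"
  shows "wp w load Q s"
  unfolding load_def
proof (rule wp_While[where I = "load_inv f n e p l1 h1 l2 h2 u B" and
      \<Phi> = "\<lambda>s. (u - reg s ''t'') + reg s ''z''" and K = "300 * (floorlog 2 n + 1)"])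
  show "load_inv f n e p l1 h1 l2 h2 u B s" by (rule I)
next
  fix s assume I: "load_inv f n e p l1 h1 l2 h2 u B s"
    and c: "cond_val w (Conj (Less (Reg ''t'') (Reg ''u'')) (Less (Const 0) (Reg ''z''))) s"
  then have t: "reg s ''t'' < u" and z: "reg s ''z'' = 1" by (auto simp: load_inv_def)
  show "wp w load_step (\<lambda>c s'. load_inv f n e p l1 h1 l2 h2 u B s' \<and>
    (u - reg s' ''t'') + reg s' ''z'' < (u - reg s ''t'') + reg s ''z'' \<and>
    c + cond_cost (Conj (Less (Reg ''t'') (Reg ''u'')) (Less (Const 0) (Reg ''z''))) + 1 \<le> 300 * (floorlog 2 n + 1)) s"
    by (rule wp_mono[OF load_step_correct[OF I t z w h B]]) auto
next
  fix c and s' :: state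
  assume I': "load_inv f n e p l1 h1 l2 h2 u B s'"
    and ex: "\<not> cond_val w (Conj (Less (Reg ''t'') (Reg ''u'')) (Less (Const 0) (Reg ''z''))) s'"
    and c: "c \<le> 300 * (floorlog 2 n + 1) * ((u - reg s ''t'') + reg s ''z'') +
      cond_cost (Conj (Less (Reg ''t'') (Reg ''u'')) (Less (Const 0) (Reg ''z''))) + 1"
  have "(u - reg s ''t'') + reg s ''z'' \<le> n + 1" using I h by (auto simp: load_inv_def)
  then have "300 * (floorlog 2 n + 1) * ((u - reg s ''t'') + reg s ''z'') \<le> 300 * (floorlog 2 n + 1) * (n + 1)"
    by (intro mult_le_mono2)
  then have "c \<le> 300 * (floorlog 2 n + 1) * (n + 1) + 10" using c by simp
  then show "Q c s'" using I' ex by (intro Q) (auto simp: load_inv_def)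
qed

text \<open>After successful loading the word is on the stack, so \<open>B\<close> can be rewritten
  from cell \<open>0\<close>. After a failure \<open>B\<close> and \<open>u\<close> still hold the
  old word.\<close>

definition extend_common :: com where
  "extend_common = block
    [Assign ''t'' (Const 0), Assign ''d'' (Const 0), Assign ''z'' (Const 1), load,
     Ite (Less (Const 0) (Reg ''z'')) (block [Assign ''u'' (Const 0), mcs_loop]) Skip]"

lemma extend_common_correct:
  assumes st: "static f n e p (reg s) (arr s)"
    and w: "(n + 2)\<^sup>2 \<le> 2 ^ w" and l: "reg s ''a'' = l1" "reg s ''b'' = l2"
    and q: "arr s ''QA'' 0 = h1" "arr s ''QB'' 0 = h2"
    and h: "l1 \<le> h1" "l2 \<le> h2" "h1 \<le> n" "h2 \<le> n"
    and u: "reg s ''u'' \<le> n" and X: "X = seg (arr s ''B'') 0 (reg s ''u'')" "\<forall>x\<in>set X. 0 < cnt f x n"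
    and Q: "\<And>c s' X'. c \<le> 300 * (floorlog 2 n + 1) * (6 * n + 4) + 50 \<Longrightarrow>
      static f n e p (reg s') (arr s') \<Longrightarrow> reg s' ''u'' \<le> n \<Longrightarrow> X' = seg (arr s' ''B'') 0 (reg s' ''u'') \<Longrightarrow>
      \<forall>x\<in>set X'. 0 < cnt f x n \<Longrightarrow> subseq X X' \<Longrightarrow>
      maximal_common f l1 h1 l2 h2 X' \<or> X' = X \<and> \<not> common f l1 h1 l2 h2 X \<Longrightarrow> Q c s'"
  shows "wp w extend_common Q s"
proof -
  have M: "n * n + 4 * n + 4 \<le> 2 ^ w" using w by (rule square_bound)
  then have "w \<noteq> 0" by (intro notI) simp
  define u where "u = reg s ''u''"
  let ?B = "arr s ''B''"
  let ?s = "s\<lparr>reg := (reg s)(''t'' := 0, ''d'' := 0, ''z'' := 1)\<rparr>"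
  have I0: "load_inv f n e p l1 h1 l2 h2 u ?B ?s"
    using st l mcs_inv_init[OF h(1,2), of "arr s ''QA''" "arr s ''QB''"] q by (simp add: load_inv_def u_def)
  have seq: "wp w load (\<lambda>c. wp w (Ite (Less (Const 0) (Reg ''z'')) (block [Assign ''u'' (Const 0), mcs_loop]) Skip) (\<lambda>c'. Q (6 + (c + c')))) ?s"
  proof (rule load_correct[OF I0 w h(3,4)])
    fix c :: nat and s' :: state assume c: "c \<le> 300 * (floorlog 2 n + 1) * (n + 1) + 10"
      and I: "load_inv f n e p l1 h1 l2 h2 u ?B s'" and fin: "reg s' ''z'' = 0 \<or> reg s' ''t'' = u"
    have c0: "300 * (floorlog 2 n + 1) * (n + 1) + 300 * (floorlog 2 n + 1) * (5 * n + 2) \<le> 300 * (floorlog 2 n + 1) * (6 * n + 4)"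
      unfolding add_mult_distrib2[symmetric] by (intro mult_le_mono2) simp
    have cost: "6 + (c + (c' + 6)) \<le> 300 * (floorlog 2 n + 1) * (6 * n + 4) + 50"
      if "c' \<le> 300 * (floorlog 2 n + 1) * (5 * n + 2) + 10" for c'
      using c c0 that by linarith
    show "wp w (Ite (Less (Const 0) (Reg ''z'')) (block [Assign ''u'' (Const 0), mcs_loop]) Skip) (\<lambda>c'. Q (6 + (c + c'))) s'"
    proof (cases "reg s' ''z'' = 0")
      case True
      have "Q (6 + (c + 5)) s'"
        by (rule Q[where X' = X]) (use True I X u cost[of 0] in \<open>auto simp: load_inv_def u_def\<close>)
      then show ?thesis using True by (simp add: eval_nat_numeral)
    next
      case False
      let ?s' = "s'\<lparr>reg := (reg s')(''u'' := 0)\<rparr>"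
      have "loop_inv f n e p l1 h1 l2 h2 0 ?B X ?s'"
        using I False fin X by (simp add: loop_inv_def load_inv_def u_def)
      then have "wp w mcs_loop (\<lambda>c'. Q (6 + (c + (c' + 6)))) ?s'"
      proof (rule mcs_loop_correct[OF _ w h(3,4)])
        fix c' :: nat and s'' :: state
        assume c': "c' \<le> 300 * (floorlog 2 n + 1) * (5 * n + 2) + 10"
          and "static f n e p (reg s'') (arr s'')" "reg s'' ''u'' \<le> 0 + n"
            "subseq X (seg (arr s'' ''B'') 0 (reg s'' ''u''))"
          and mx: "maximal_common f l1 h1 l2 h2 (seg (arr s'' ''B'') 0 (reg s'' ''u''))"
        have "0 < cnt f x n" if "x \<in> set (seg (arr s'' ''B'') 0 (reg s'' ''u''))" for x
        proof -
          have "x \<in> set (seg f l1 h1)" using mx that subseq_setD unfolding maximal_common_def common_def by blast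
          then obtain i where "i < h1" "f i = x" by (auto simp: in_set_seg)
          then show ?thesis using cnt_pos[of i n f] h by auto
        qed
        then show "Q (6 + (c + (c' + 6))) s''"
          using cost[OF c'] mx \<open>static f n e p (reg s'') (arr s'')\<close> \<open>reg s'' ''u'' \<le> 0 + n\<close>
            \<open>subseq X (seg (arr s'' ''B'') 0 (reg s'' ''u''))\<close>
          by (intro Q[where X' = "seg (arr s'' ''B'') 0 (reg s'' ''u'')"]) auto
      qed simp
      then show ?thesis using False by (simp add: eval_nat_numeral)
    qed
  qed (use u X in \<open>simp_all add: u_def\<close>)
  then show ?thesis
    using \<open>w \<noteq> 0\<close> by (simp add: extend_common_def eval_nat_numeral)
qed

section \<open>Indexing the input\<close>

text \<open>A letter is a word and serves as an address, so no sorting or hashing is needed. Its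
  block in \<open>OCC\<close> starts at \<open>n + 1\<close> times its first position; this keeps
  blocks disjoint and all addresses below \<open>(n + 2)\<^sup>2\<close>.\<close>

definition index_step :: com where
  "index_step = block
    [Assign ''x'' (Load ''S'' (Reg ''i'')),
     Ite (Equal (Load ''CNT'' (Reg ''x'')) (Const 0))
       (Store ''BASE'' (Reg ''x'') (Op Mul (Reg ''i'') (add (Reg ''n'') (Const 1))))
       (Assign ''e'' (add (Reg ''i'') (Const 1))),
     Store ''OCC'' (add (add (Load ''BASE'' (Reg ''x'')) (Load ''CNT'' (Reg ''x''))) (Const 1)) (add (Reg ''i'') (Const 1)),
     Store ''CNT'' (Reg ''x'') (add (Load ''CNT'' (Reg ''x'')) (Const 1)),
     Assign ''i'' (add (Reg ''i'') (Const 1))]"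

definition index :: com where
  "index = While (Less (Reg ''i'') (Reg ''n'')) index_step"

definition index_tables :: "(nat \<Rightarrow> nat) \<Rightarrow> nat \<Rightarrow> nat \<Rightarrow> (string \<Rightarrow> nat \<Rightarrow> nat) \<Rightarrow> bool" where
  "index_tables f n i A \<longleftrightarrow> A ''S'' = f \<and> (\<forall>x. A ''CNT'' x = cnt f x i) \<and>
     (\<forall>x. 0 < cnt f x i \<longrightarrow> (\<exists>j<i. f j = x \<and> A ''BASE'' x = j * (n + 1))) \<and>
     (\<forall>j. A ''OCC'' (j * (n + 1)) = 0) \<and>
     (\<forall>x k. k < cnt f x i \<longrightarrow> (\<exists>j<i. f j = x \<and> cnt f x j = k \<and> A ''OCC'' (A ''BASE'' x + k + 1) = j + 1))"

text \<open>The boundary \<open>e\<close> is the successor of the last position whose letter occurs earlier, or \<open>0\<close>.\<close>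

definition last_repeated :: "(nat \<Rightarrow> nat) \<Rightarrow> nat \<Rightarrow> nat \<Rightarrow> bool" where
  "last_repeated f i e \<longleftrightarrow> e \<le> i \<and> (0 < e \<longrightarrow> 0 < cnt f (f (e - 1)) (e - 1)) \<and>
     (\<forall>j. e \<le> j \<longrightarrow> j < i \<longrightarrow> cnt f (f j) j = 0)"

lemma index_tables_step:
  assumes T: "index_tables f n i A" and i: "i < n" and x: "x = f i"
    and b: "b = (if cnt f x i = 0 then i * (n + 1) else A ''BASE'' x)"
  shows "index_tables f n (Suc i) (A(''BASE'' := (A ''BASE'')(x := b),
    ''OCC'' := (A ''OCC'')(b + cnt f x i + 1 := i + 1), ''CNT'' := (A ''CNT'')(x := cnt f x i + 1)))"
    (is "index_tables f n _ ?A")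
    and "b + cnt f x i + 1 < (n + 2)\<^sup>2"
proof -
  note T' = T[unfolded index_tables_def, THEN conjunct2, THEN conjunct2]
  have base: "\<exists>j<i. f j = x \<and> A ''BASE'' x = j * (n + 1)" if "0 < cnt f x i" for x
    using conjunct1[OF T'] that by blast
  have zero: "A ''OCC'' (j * (n + 1)) = 0" for j
    using conjunct1[OF conjunct2[OF T']] by blast
  have occ: "\<exists>j<i. f j = x \<and> cnt f x j = k \<and> A ''OCC'' (A ''BASE'' x + k + 1) = j + 1" if "k < cnt f x i" for x k
    using conjunct2[OF conjunct2[OF T']] that by blast
  obtain j0 where j0: "j0 \<le> i" "f j0 = x" "b = j0 * (n + 1)"
    using base[of x] x b by (cases "cnt f x i = 0") (auto intro: less_imp_le)
  have c: "cnt f x i + 1 \<le> n" using cnt_le[of f x i] i by simp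
  \<comment> \<open>Offsets are at most \<open>n\<close>, so a cell determines its block and offset.
    Blocks do not overlap, and the \<open>0\<close> at offset \<open>0\<close> is never
    overwritten.\<close>
  have inj: "j = j' \<and> k = k'" if "j * (n + 1) + k = j' * (n + 1) + k'" "k \<le> n" "k' \<le> n" for j j' k k'
  proof -
    have "(j * (n + 1) + k) div (n + 1) = j" "(j' * (n + 1) + k') div (n + 1) = j'"
      using that(2,3) by (subst div_mult_self3; simp)+
    then have "j = j'" using that(1) by argo
    then show ?thesis using that(1) by simp
  qed
  have "j0 * (n + 1) \<le> n * (n + 1)" using j0 i by (intro mult_le_mono1) simp
  then show "b + cnt f x i + 1 < (n + 2)\<^sup>2" using j0 c by (simp add: power2_eq_square)
  have 1: "\<exists>j<Suc i. f j = y \<and> ?A ''BASE'' y = j * (n + 1)" if "0 < cnt f y (Suc i)" for y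
  proof (cases "y = x")
    case True
    then show ?thesis using j0 by (intro exI[of _ j0]) simp
  next
    case False
    then have "0 < cnt f y i" using that x by (auto simp: cnt_Suc split: if_splits)
    then obtain j where "j < i" "f j = y" "A ''BASE'' y = j * (n + 1)" using base by blast
    then show ?thesis using False by (intro exI[of _ j]) simp
  qed
  have 2: "?A ''OCC'' (j * (n + 1)) = 0" for j
    using zero[of j] inj[of j 0 j0 "cnt f x i + 1"] c j0 by auto
  have 3: "\<exists>j<Suc i. f j = y \<and> cnt f y j = k \<and> ?A ''OCC'' (?A ''BASE'' y + k + 1) = j + 1"
    if k: "k < cnt f y (Suc i)" for y k
  proof (cases "y = x \<and> k = cnt f x i")
    case True
    then show ?thesis using x by (intro exI[of _ i]) auto
  next
    case False
    then have k': "k < cnt f y i" using k x by (auto simp: cnt_Suc split: if_splits)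
    then obtain j where j: "j < i" "f j = y" "cnt f y j = k" "A ''OCC'' (A ''BASE'' y + k + 1) = j + 1"
      using occ by blast
    obtain j1 where j1: "j1 < i" "f j1 = y" "A ''BASE'' y = j1 * (n + 1)" using base[of y] k' by auto
    have B: "?A ''BASE'' y = A ''BASE'' y" using k' b by (cases "y = x") simp_all
    have "k + 1 \<le> n" using k' cnt_le[of f y i] i by simp
    then have "A ''BASE'' y + k + 1 \<noteq> b + cnt f x i + 1"
      using inj[of j1 "k + 1" j0 "cnt f x i + 1"] c j1 j0 False by (auto simp only: add.assoc add_right_cancel)
    then have "?A ''OCC'' (?A ''BASE'' y + k + 1) = j + 1" using j(4) B by simp
    then show ?thesis using j by (intro exI[of _ j] conjI) simp_all
  qed
  have 4: "?A ''CNT'' y = cnt f y (Suc i)" for y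
    using T x by (simp add: index_tables_def cnt_Suc)
  show "index_tables f n (Suc i) ?A"
    unfolding index_tables_def using conjunct1[OF T[unfolded index_tables_def]] 1 2 3 4
    by (intro conjI allI impI) simp_all
qed

lemma index_step_correct:
  assumes T: "index_tables f n i (arr s)" and E: "last_repeated f i (reg s ''e'')"
    and r: "reg s ''i'' = i" "reg s ''n'' = n" "reg s ''u'' = 0" and i: "i < n" and w: "(n + 2)\<^sup>2 \<le> 2 ^ w"
  shows "wp w index_step (\<lambda>c s'. c + 4 \<le> 60 \<and> index_tables f n (Suc i) (arr s') \<and>
    last_repeated f (Suc i) (reg s' ''e'') \<and> reg s' ''i'' = Suc i \<and> reg s' ''n'' = n \<and> reg s' ''u'' = 0) s"
proof -
  have M: "n * n + 4 * n + 4 \<le> 2 ^ w" using w by (rule square_bound)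
  then have "w \<noteq> 0" by (intro notI) simp
  define x where "x = f i"
  define b where "b = (if cnt f x i = 0 then i * (n + 1) else arr s ''BASE'' x)"
  note step = index_tables_step[OF T i x_def b_def]
  have b: "b + cnt f x i + 1 < 2 ^ w" using step(2) w by (rule less_le_trans)
  have "i * (n + 1) \<le> n * (n + 1)" using i by (intro mult_le_mono1) simp
  then have m: "Suc n mod 2 ^ w = Suc n" "Suc i mod 2 ^ w = Suc i" "(i + i * n) mod 2 ^ w = i + i * n"
    "(b + cnt f x i) mod 2 ^ w = b + cnt f x i" "Suc (b + cnt f x i) mod 2 ^ w = Suc (b + cnt f x i)"
    "Suc (cnt f x i) mod 2 ^ w = Suc (cnt f x i)"
    using M b i by auto
  have A: "arr s ''S'' = f" "arr s ''CNT'' = (\<lambda>y. cnt f y i)" using T by (simp_all add: index_tables_def fun_eq_iff)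
  show ?thesis
  proof (cases "cnt f x i = 0")
    case True
    then have "b = i + i * n" by (simp add: b_def)
    moreover have "last_repeated f (Suc i) (reg s ''e'')"
      using E True by (auto simp: last_repeated_def x_def less_Suc_eq)
    ultimately show ?thesis
      using step(1) m A r True \<open>w \<noteq> 0\<close>
      by (simp add: index_step_def x_def[symmetric])
  next
    case False
    then have b': "arr s ''BASE'' x = b" by (simp add: b_def)
    moreover have "last_repeated f (Suc i) (Suc i)"
      using False by (simp add: last_repeated_def x_def)
    moreover have "(arr s)(''BASE'' := (arr s ''BASE'')(x := b)) = arr s" using b' by auto
    ultimately show ?thesis
      using step(1) m A r False \<open>w \<noteq> 0\<close>
      by (simp add: index_step_def x_def[symmetric])
  qed
qed

lemma index_correct:
  assumes T: "index_tables f n 0 (arr s)" and r: "reg s ''e'' = 0" "reg s ''i'' = 0" "reg s ''n'' = n" "reg s ''u'' = 0"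
    and w: "(n + 2)\<^sup>2 \<le> 2 ^ w"
  shows "wp w index (\<lambda>c s'. c \<le> 60 * n + 4 \<and> static f n (reg s' ''e'') (reg s' ''f'') (reg s') (arr s') \<and>
    last_repeated f n (reg s' ''e'') \<and> reg s' ''u'' = 0) s"
proof -
  have "wp w index (\<lambda>c s'. c \<le> 60 * n + 4 \<and> reg s' ''n'' = n \<and> index_tables f n n (arr s') \<and>
    last_repeated f n (reg s' ''e'') \<and> reg s' ''u'' = 0) s"
    unfolding index_def
  proof (rule wp_While[where K = 60 and \<Phi> = "\<lambda>s. n - reg s ''i''" and I = "\<lambda>s. index_tables f n (reg s ''i'') (arr s) \<and>
      last_repeated f (reg s ''i'') (reg s ''e'') \<and> reg s ''i'' \<le> n \<and> reg s ''n'' = n \<and> reg s ''u'' = 0"])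
    show "index_tables f n (reg s ''i'') (arr s) \<and> last_repeated f (reg s ''i'') (reg s ''e'') \<and>
        reg s ''i'' \<le> n \<and> reg s ''n'' = n \<and> reg s ''u'' = 0"
      using T r by (simp add: last_repeated_def)
  next
    fix s assume *: "index_tables f n (reg s ''i'') (arr s) \<and> last_repeated f (reg s ''i'') (reg s ''e'') \<and>
        reg s ''i'' \<le> n \<and> reg s ''n'' = n \<and> reg s ''u'' = 0" and "cond_val w (Less (Reg ''i'') (Reg ''n'')) s"
    then have "reg s ''i'' < n" by simp
    with * show "wp w index_step (\<lambda>c s'. (index_tables f n (reg s' ''i'') (arr s') \<and>
        last_repeated f (reg s' ''i'') (reg s' ''e'') \<and> reg s' ''i'' \<le> n \<and> reg s' ''n'' = n \<and> reg s' ''u'' = 0) \<and>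
        n - reg s' ''i'' < n - reg s ''i'' \<and> c + cond_cost (Less (Reg ''i'') (Reg ''n'')) + 1 \<le> 60) s"
      by (intro wp_mono[OF index_step_correct[OF _ _ refl _ _ _ w]]) auto
  qed (use r in auto)
  then show ?thesis
  proof (rule wp_mono)
    fix c and s' :: state
    assume *: "c \<le> 60 * n + 4 \<and> reg s' ''n'' = n \<and> index_tables f n n (arr s') \<and>
      last_repeated f n (reg s' ''e'') \<and> reg s' ''u'' = 0"
    have "arr s' ''BASE'' x + n < (n + 2)\<^sup>2 \<and> arr s' ''OCC'' (arr s' ''BASE'' x) = 0" if "0 < cnt f x n" for x
    proof -
      obtain j where j: "j < n" "arr s' ''BASE'' x = j * (n + 1)" and "arr s' ''OCC'' (j * (n + 1)) = 0"
        using * \<open>0 < cnt f x n\<close> unfolding index_tables_def by blast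
      moreover have "j * (n + 1) \<le> n * (n + 1)" using j by (intro mult_le_mono1) simp
      ultimately show ?thesis by (simp add: power2_eq_square)
    qed
    then show "c \<le> 60 * n + 4 \<and> static f n (reg s' ''e'') (reg s' ''f'') (reg s') (arr s') \<and>
        last_repeated f n (reg s' ''e'') \<and> reg s' ''u'' = 0"
      using * unfolding static_def index_tables_def by blast
  qed
qed

lemma static_f [simp]:
  "static f n e p (R(''f'' := v)) A \<longleftrightarrow> v = p \<and> static f n e (R ''f'') R A"
  by (auto simp: static_def)

lemma static_same: "static f n e p R A \<Longrightarrow> R ''f'' = p"
  by (simp add: static_def)

section \<open>The initial block of equal letters\<close>

definition fill_step :: com where
  "fill_step = block [Store ''B'' (Reg ''u'') (Reg ''x''), Assign ''u'' (add (Reg ''u'') (Const 1))]"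

definition fill :: com where
  "fill = While (Less (Reg ''u'') (Reg ''m'')) fill_step"

lemma fill_correct:
  assumes r: "reg s ''u'' = 0" "reg s ''m'' = m" "m \<le> n" and w: "(n + 2)\<^sup>2 \<le> 2 ^ w"
  shows "wp w fill (\<lambda>c s'. c \<le> 20 * n + 4 \<and>
    (\<exists>B. s' = s\<lparr>arr := (arr s)(''B'' := B), reg := (reg s)(''u'' := m)\<rparr> \<and> (\<forall>i<m. B i = reg s ''x''))) s"
  unfolding fill_def
proof (rule wp_While[where K = 20 and \<Phi> = "\<lambda>s. m - reg s ''u''" and
      I = "\<lambda>s'. \<exists>B u. s' = s\<lparr>arr := (arr s)(''B'' := B), reg := (reg s)(''u'' := u)\<rparr> \<and> u \<le> m \<and> (\<forall>i<u. B i = reg s ''x'')"])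
  have "s = s\<lparr>arr := (arr s)(''B'' := arr s ''B''), reg := (reg s)(''u'' := 0)\<rparr>"
    using r(1) by (cases s) (auto simp: fun_eq_iff)
  then show "\<exists>B u. s = s\<lparr>arr := (arr s)(''B'' := B), reg := (reg s)(''u'' := u)\<rparr> \<and> u \<le> m \<and> (\<forall>i<u. B i = reg s ''x'')"
    by (intro exI[of _ "arr s ''B''"] exI[of _ 0]) simp
next
  fix s1 assume "\<exists>B u. s1 = s\<lparr>arr := (arr s)(''B'' := B), reg := (reg s)(''u'' := u)\<rparr> \<and> u \<le> m \<and> (\<forall>i<u. B i = reg s ''x'')"
    and c: "cond_val w (Less (Reg ''u'') (Reg ''m'')) s1"
  then obtain B u where s1: "s1 = s\<lparr>arr := (arr s)(''B'' := B), reg := (reg s)(''u'' := u)\<rparr>"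
    and u: "u < m" "\<forall>i<u. B i = reg s ''x''" using r by auto
  have M: "n * n + 4 * n + 4 \<le> 2 ^ w" using w by (rule square_bound)
  then have "w \<noteq> 0" by (intro notI) simp
  have "Suc u mod 2 ^ w = Suc u" using u(1) r(3) M by simp
  then show "wp w fill_step (\<lambda>c s'. (\<exists>B u. s' = s\<lparr>arr := (arr s)(''B'' := B), reg := (reg s)(''u'' := u)\<rparr> \<and> u \<le> m \<and> (\<forall>i<u. B i = reg s ''x'')) \<and>
      m - reg s' ''u'' < m - reg s1 ''u'' \<and> c + cond_cost (Less (Reg ''u'') (Reg ''m'')) + 1 \<le> 20) s1"
    using u s1 \<open>w \<noteq> 0\<close> apply (simp add: fill_step_def)
    apply (intro conjI)
    by (intro exI[of _ "B(u := reg s ''x'')"] exI[of _ "Suc u"]) (auto simp: less_Suc_eq)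
next
  fix c and s' :: state
  assume I: "\<exists>B u. s' = s\<lparr>arr := (arr s)(''B'' := B), reg := (reg s)(''u'' := u)\<rparr> \<and> u \<le> m \<and> (\<forall>i<u. B i = reg s ''x'')"
    and ex: "\<not> cond_val w (Less (Reg ''u'') (Reg ''m'')) s'"
    and c: "c \<le> 20 * (m - reg s ''u'') + cond_cost (Less (Reg ''u'') (Reg ''m'')) + 1"
  obtain B u where s': "s' = s\<lparr>arr := (arr s)(''B'' := B), reg := (reg s)(''u'' := u)\<rparr>"
    and u: "u \<le> m" "\<forall>i<u. B i = reg s ''x''" using I by blast
  moreover have "u = m" using ex s' u(1) r(2) by simp
  ultimately show "c \<le> 20 * n + 4 \<and>
    (\<exists>B. s' = s\<lparr>arr := (arr s)(''B'' := B), reg := (reg s)(''u'' := m)\<rparr> \<and> (\<forall>i<m. B i = reg s ''x''))"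
    using c r(3) by auto
qed

text \<open>The occurrence at \<open>e - 1\<close> is not the first one, and a further one from
  \<open>e\<close> on would be a later repetition.\<close>

lemma last_repeated_cnt:
  assumes L: "last_repeated f n e" "0 < e" and c: "c = f (e - 1)"
  shows "2 \<le> cnt f c e" "cnt f c n = cnt f c e" 
proof -
  have *: "e \<le> n" "0 < cnt f c (e - 1)" "\<And>j. e \<le> j \<Longrightarrow> j < n \<Longrightarrow> cnt f (f j) j = 0"
    using L c unfolding last_repeated_def by blast+
  have "cnt f c (Suc (e - 1)) = Suc (cnt f c (e - 1))" using c by (simp add: cnt_Suc)
  then show 2: "2 \<le> cnt f c e" using * L(2) by simp
  have "c \<notin> set (seg f e n)"
  proof
    assume "c \<in> set (seg f e n)"
    then obtain j where "e \<le> j" "j < n" "f j = c" by (auto simp: in_set_seg)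
    then show False using *(3)[of j] cnt_mono[of e j f c] 2 by simp
  qed
  then show "cnt f c n = cnt f c e" using notin_seg_iff[OF *(1), of c f] by blast
qed

text \<open>Entries \<open>m\<close>, \<open>m + 1\<close> and \<open>2 * m\<close> of the block of
  \<open>x\<close> are the successors of \<open>p\<close>, \<open>p'\<close> and \<open>r\<close>.
  So \<open>a\<close> and \<open>b\<close> are window starts as loaded, and \<open>f\<close> keeps
  the second cut \<open>Suc p'\<close>. The first window ends before \<open>p'\<close>, hence the
  subtraction of 1; register \<open>e\<close> is already an exclusive end.\<close>

definition prepare :: com where
  "prepare = block
    [Assign ''x'' (Load ''S'' (sub (Reg ''e'') (Const 1))),
     Assign ''m'' (half (Load ''CNT'' (Reg ''x''))),
     Assign ''h'' (add (Load ''BASE'' (Reg ''x'')) (Reg ''m'')),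
     Assign ''a'' (Load ''OCC'' (Reg ''h'')),
     Assign ''f'' (Load ''OCC'' (add (Reg ''h'') (Const 1))),
     Assign ''b'' (Load ''OCC'' (add (Reg ''h'') (Reg ''m''))),
     Assign ''u'' (Const 0),
     fill,
     Store ''QA'' (Const 0) (sub (Reg ''f'') (Const 1)),
     Store ''QB'' (Const 0) (Reg ''e''),
     Assign ''t'' (Const 0), Assign ''d'' (Const 0), Assign ''z'' (Const 1)]"

lemma prepare_correct:
  assumes st: "static f n e q (reg s) (arr s)" and L: "last_repeated f n e" "0 < e"
    and w: "(n + 2)\<^sup>2 \<le> 2 ^ w"
  shows "wp w prepare (\<lambda>c s'. c \<le> 20 * n + 100 \<and> (\<exists>m p p' r B.
    repeated_letter f (f (e - 1)) m p p' r (e - 1) \<and> (\<forall>i<m. B i = f (e - 1)) \<and> m \<le> n \<and>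
    loop_inv f n e (Suc p') (Suc p) p' (Suc r) e m B [] s')) s"
proof -
  have M: "n * n + 4 * n + 4 \<le> 2 ^ w" using w by (rule square_bound)
  then have "w \<noteq> 0" by (intro notI) simp
  then have two: "2 mod 2 ^ w = (2::nat)" using M by simp
  define x where "x = f (e - 1)"
  define m where "m = cnt f x n div 2"
  note cn = last_repeated_cnt[OF L x_def]
  have "e \<le> n" using L(1) by (simp add: last_repeated_def)
  have m: "1 \<le> m" "2 * m \<le> cnt f x n" "cnt f x n \<le> 2 * m + 1" "m < cnt f x n" and x0: "0 < cnt f x n"
    using cn by (auto simp: m_def)
  have "m \<le> n" using m(4) cnt_le[of f x n] by simp
  have S: "arr s ''S'' = f" "arr s ''CNT'' x = cnt f x n" "reg s ''e'' = e" using st by (simp_all add: static_def)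
  define h where "h = arr s ''BASE'' x"
  have O: "\<exists>i<n. f i = x \<and> cnt f x i = k \<and> arr s ''OCC'' (h + k + 1) = i + 1" if "k < cnt f x n" for k
    using st x0 that unfolding static_def h_def by blast
  have m1: "m - 1 < cnt f x n" "2 * m - 1 < cnt f x n" "h + (m - 1) + 1 = h + m" "h + (2 * m - 1) + 1 = h + m + m"
    using m by linarith+
  obtain p where p: "f p = x" "cnt f x p = m - 1" "arr s ''OCC'' (h + m) = Suc p"
    using O[OF m1(1)] unfolding m1(3) by auto
  obtain p' where p': "f p' = x" "cnt f x p' = m" "arr s ''OCC'' (Suc (h + m)) = Suc p'"
    using O[OF m(4)] by auto
  obtain r where r: "f r = x" "cnt f x r = 2 * m - 1" "arr s ''OCC'' (h + m + m) = Suc r"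
    using O[OF m1(2)] unfolding m1(4) by auto
  have "h + n < (n + 2)\<^sup>2" unfolding h_def using st x0 by (rule base_bound)
  then have "h + n < 2 ^ w" using w by (rule less_le_trans)
  moreover have "2 * m \<le> n" using m(2) cnt_le[of f x n] by simp
  ultimately have small: "(h + m) mod 2 ^ w = h + m" "Suc (h + m) mod 2 ^ w = Suc (h + m)"
    "(h + m + m) mod 2 ^ w = h + m + m" using m by auto
  have rep: "repeated_letter f x m p p' r (e - 1)"
    using p p' r m cn L(2) by (simp add: repeated_letter_def x_def)
  note ord = repeated_letter_order[OF rep]
  have re: "Suc r \<le> e" using ord(3) L(2) by simp
  have inv: "loop_inv f n e (Suc p') (Suc p) p' (Suc r) e m B [] s'"
    if "static f n e (Suc p') (reg s') (arr s')" "reg s' ''a'' = Suc p" "reg s' ''b'' = Suc r" "reg s' ''u'' = m"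
      "arr s' ''QA'' 0 = p'" "arr s' ''QB'' 0 = e" "reg s' ''t'' = 0" "reg s' ''d'' = 0" "reg s' ''z'' = 1"
      "arr s' ''B'' = B" for s' B
    using that mcs_inv_init[of "Suc p" p' "Suc r" e] ord(1) re by (simp add: loop_inv_def)
  let ?s = "s\<lparr>reg := (reg s)(''x'' := x, ''m'' := m, ''h'' := h + m, ''a'' := Suc p, ''f'' := Suc p', ''b'' := Suc r, ''u'' := 0)\<rparr>"
  have fill: "wp w fill (\<lambda>c s'. c \<le> 20 * n + 4 \<and> (\<exists>B. s' = ?s\<lparr>arr := (arr ?s)(''B'' := B), reg := (reg ?s)(''u'' := m)\<rparr> \<and>
      (\<forall>i<m. B i = reg ?s ''x''))) ?s"
    by (rule fill_correct[OF _ _ \<open>m \<le> n\<close> w]) simp_all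
  have x: "f (e - Suc 0) = x" by (simp add: x_def)
  have st': "static f n e (reg s ''f'') (reg s) (arr s)" using st static_same[OF st] by simp
  have rep': "repeated_letter f x m p p' r (e - Suc 0)" using rep by simp
  show ?thesis
    apply (simp add: prepare_def S x m_def[symmetric] h_def[symmetric] two \<open>w \<noteq> 0\<close> small p p' r)
    apply (rule wp_mono[OF fill])
    apply (elim conjE exE)
    apply (simp add: S \<open>w \<noteq> 0\<close>)
    apply (rule exI[of _ m], rule exI[of _ p], rule exI[of _ p'], rule exI[of _ r], rule conjI, rule rep')
    subgoal for c s' B
      by (rule exI[of _ B], intro conjI inv) (use \<open>m \<le> n\<close> st' in auto)
    done
qed

section \<open>The algorithm\<close>

text \<open>Register \<open>y\<close> is read before \<open>a\<close> is cleared because it may be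
  \<open>a\<close> itself: the preceding loop leaves there the end \<open>v\<close> of the leftmost
  embedding of \<open>V\<close>, which is the first cut.\<close>

definition refine_at :: "string \<Rightarrow> com" where
  "refine_at y = block
    [Store ''QA'' (Const 0) (Reg y), Store ''QB'' (Const 0) (Reg ''e''),
     Assign ''b'' (Reg y), Assign ''a'' (Const 0), extend_common]"

definition stages :: com where
  "stages = block [mcs_loop, refine_at ''a'', refine_at ''f'']"

text \<open>The factor \<open>17 * n + 10\<close> is \<open>5 * n + 2\<close> for the loop that
  finds \<open>V\<close> plus twice \<open>6 * n + 4\<close> for the refinements. These are treated
  backwards, each providing the postcondition of its predecessor.\<close>

lemma stages_correct:
  assumes rep: "repeated_letter f c m p p' r (e - 1)" and B: "\<forall>i<m. B i = c" and m: "m \<le> n"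
    and I: "loop_inv f n e (Suc p') (Suc p) p' (Suc r) e m B [] s" and e: "0 < e" "e \<le> n"
    and w: "(n + 2)\<^sup>2 \<le> 2 ^ w"
  shows "wp w stages (\<lambda>k s'. k \<le> 300 * (floorlog 2 n + 1) * (17 * n + 10) + 200 \<and> reg s' ''u'' \<le> n \<and>
    subseq (seg (arr s' ''B'') 0 (reg s' ''u'') @ seg (arr s' ''B'') 0 (reg s' ''u'')) (seg f 0 e) \<and>
    (\<forall>Z. subseq (Z @ Z) (seg f 0 e) \<and> subseq (seg (arr s' ''B'') 0 (reg s' ''u'')) Z \<longrightarrow>
      Z = seg (arr s' ''B'') 0 (reg s' ''u''))) s" (is "wp w stages ?Q s")
proof -
  have M: "n * n + 4 * n + 4 \<le> 2 ^ w" using w by (rule square_bound)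
  then have "w \<noteq> 0" by (intro notI) simp
  note ord = repeated_letter_order[OF rep]
  have p'e: "p' < e" using ord e by simp
  have e1: "Suc (e - 1) = e" using e by simp
  have letters: "\<forall>x\<in>set X. 0 < cnt f x n" if "subseq X (seg f l h)" "h \<le> n" for X l h
  proof
    fix x assume "x \<in> set X"
    then have "x \<in> set (seg f l h)" using subseq_setD[OF that(1)] by blast
    then obtain i where "i < h" "f i = x" by (auto simp: in_set_seg)
    then show "0 < cnt f x n" using cnt_pos[of i n f] that(2) by auto
  qed
  define K where "K = 300 * (floorlog 2 n + 1)"
  have second: "wp w (refine_at ''f'') (\<lambda>k. ?Q (k0 + k)) s'"
    if k0: "k0 \<le> K * (11 * n + 6) + 100"
      and st: "static f n e (Suc p') (reg s') (arr s')"
      and V: "maximal_common f (Suc p) p' (Suc r) e V" "Lres f (Suc p) p' V v"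
      and u: "reg s' ''u'' \<le> n" and X: "X = seg (arr s' ''B'') 0 (reg s' ''u'')" "\<forall>x\<in>set X. 0 < cnt f x n"
      and WX: "subseq (replicate m c @ V) X" "maximal_common f 0 v v e X"
    for s' k0 V v X
  proof -
    have r': "reg s' ''f'' = Suc p'" "reg s' ''e'' = e" using st by (simp_all add: static_def)
    have "wp w extend_common (\<lambda>k. ?Q (k0 + (10 + k)))
      (s'\<lparr>arr := (arr s')(''QA'' := (arr s' ''QA'')(0 := Suc p'), ''QB'' := (arr s' ''QB'')(0 := e)),
        reg := (reg s')(''b'' := Suc p', ''a'' := 0)\<rparr>)"
    proof (rule extend_common_correct[where ?l1.0 = 0 and ?l2.0 = "Suc p'" and ?h1.0 = "Suc p'" and ?h2.0 = e and X = X and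
          f = f and n = n and e = e and p = "Suc p'", OF _ w])
      fix k :: nat and s'' :: state and X'
      assume k: "k \<le> 300 * (floorlog 2 n + 1) * (6 * n + 4) + 50" and "reg s'' ''u'' \<le> n"
        and X': "X' = seg (arr s'' ''B'') 0 (reg s'' ''u'')" "subseq X X'"
          "maximal_common f 0 (Suc p') (Suc p') e X' \<or> X' = X \<and> \<not> common f 0 (Suc p') (Suc p') e X"
      have "K * (11 * n + 6) + K * (6 * n + 4) = K * (17 * n + 10)" by (simp add: algebra_simps)
      then have "k0 + (10 + k) \<le> K * (17 * n + 10) + 200"
        using k0 k unfolding K_def[symmetric] by linarith
      moreover note fin = repeated_letter_maximal[OF rep, unfolded e1, OF V WX X'(2,3)]
      ultimately show "?Q (k0 + (10 + k)) s''"
        using \<open>reg s'' ''u'' \<le> n\<close> fin unfolding K_def X'(1) by blast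
    qed (use st u X p'e e in simp_all)
    then show ?thesis using \<open>w \<noteq> 0\<close> r' by (simp add: refine_at_def)
  qed
  have first: "wp w (refine_at ''a'') (\<lambda>k. wp w (refine_at ''f'') (\<lambda>k'. ?Q (k0 + (k + k')))) s'"
    if k0: "k0 \<le> K * (5 * n + 2) + 10"
      and st: "static f n e (Suc p') (reg s') (arr s')"
      and V: "maximal_common f (Suc p) p' (Suc r) e V" "Lres f (Suc p) p' V (reg s' ''a'')"
      and W: "seg (arr s' ''B'') 0 (reg s' ''u'') = replicate m c @ V"
    for s' k0 V
  proof -
    define v where "v = reg s' ''a''"
    have r': "reg s' ''e'' = e" using st by (simp_all add: static_def)
    have v: "v \<le> p'" using V(2) by (simp add: Lres_def v_def)
    have com: "common f 0 v v e (replicate m c @ V)"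
      using repeated_letter_start[OF rep, unfolded e1, of V v] V by (simp add: maximal_common_def v_def)
    then have len: "reg s' ''u'' \<le> v"
      using list_emb_length[of "(=)" "replicate m c @ V" "seg f 0 v"] arg_cong[OF W, of length]
      by (simp add: common_def)
    have occ: "\<forall>x\<in>set (replicate m c @ V). 0 < cnt f x n"
      by (rule letters[of _ 0 v]) (use com v p'e e in \<open>simp_all add: common_def\<close>)
    have "wp w extend_common (\<lambda>k. wp w (refine_at ''f'') (\<lambda>k'. ?Q (k0 + ((10 + k) + k'))))
      (s'\<lparr>arr := (arr s')(''QA'' := (arr s' ''QA'')(0 := v), ''QB'' := (arr s' ''QB'')(0 := e)),
        reg := (reg s')(''b'' := v, ''a'' := 0)\<rparr>)"
    proof (rule extend_common_correct[where ?l1.0 = 0 and ?l2.0 = v and ?h1.0 = v and ?h2.0 = e and X = "replicate m c @ V" and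
          f = f and n = n and e = e and p = "Suc p'", OF _ w])
      fix k :: nat and s'' :: state and X'
      assume k: "k \<le> 300 * (floorlog 2 n + 1) * (6 * n + 4) + 50" and st'': "static f n e (Suc p') (reg s'') (arr s'')"
        and u: "reg s'' ''u'' \<le> n"
        and X': "X' = seg (arr s'' ''B'') 0 (reg s'' ''u'')" "\<forall>x\<in>set X'. 0 < cnt f x n" "subseq (replicate m c @ V) X'"
          "maximal_common f 0 v v e X' \<or> X' = replicate m c @ V \<and> \<not> common f 0 v v e (replicate m c @ V)"
      have "K * (5 * n + 2) + K * (6 * n + 4) = K * (11 * n + 6)" by (simp add: algebra_simps)
      then have k': "k0 + (10 + k) \<le> K * (11 * n + 6) + 100"
        using k0 k unfolding K_def[symmetric] by linarith
      \<comment> \<open>The start word is common at this cut, which rules out the infeasible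
        alternative.\<close>
      have mx: "maximal_common f 0 v v e X'" using X'(4) com by blast
      show "wp w (refine_at ''f'') (\<lambda>k'. ?Q (k0 + ((10 + k) + k'))) s''"
        using second[OF k' st'' V(1) V(2)[folded v_def] u X'(1,2,3) mx] by (simp only: add.assoc)
    qed (use st len v p'e e W occ in \<open>simp_all add: v_def\<close>)
    then show ?thesis using \<open>w \<noteq> 0\<close> r' by (simp add: refine_at_def v_def)
  qed
  have p'n: "p' \<le> n" using p'e e by simp
  show ?thesis
    unfolding stages_def block.simps wp_Seq
  proof (rule mcs_loop_correct[OF I w p'n e(2) m])
    fix k :: nat and s' :: state
    assume k: "k \<le> 300 * (floorlog 2 n + 1) * (5 * n + 2) + 10" and st: "static f n e (Suc p') (reg s') (arr s')"
      and mu: "m \<le> reg s' ''u''" and L: "Lres f (Suc p) p' (seg (arr s' ''B'') m (reg s' ''u'')) (reg s' ''a'')"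
      and mx: "maximal_common f (Suc p) p' (Suc r) e (seg (arr s' ''B'') m (reg s' ''u''))"
      and B': "\<forall>i<m. arr s' ''B'' i = B i"
    have "seg (arr s' ''B'') 0 m = replicate m c"
      by (rule nth_equalityI) (use B B' in \<open>simp_all add: seg_def\<close>)
    then have W: "seg (arr s' ''B'') 0 (reg s' ''u'') = replicate m c @ seg (arr s' ''B'') m (reg s' ''u'')"
      using seg_split[of 0 m "reg s' ''u''" "arr s' ''B''"] mu by simp
    show "wp w (refine_at ''a'') (\<lambda>k1. wp w (refine_at ''f'') (\<lambda>k'. ?Q (k + (k1 + k')))) s'"
      by (rule first[OF k[folded K_def] st mx L W])
  qed
qed

section \<open>Writing the half twice\<close>

definition double_step :: com where
  "double_step = block [Store ''B'' (add (Reg ''u'') (Reg ''i'')) (Load ''B'' (Reg ''i'')), Assign ''i'' (add (Reg ''i'') (Const 1))]"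

definition double :: com where
  "double = block
    [Assign ''i'' (Const 0),
     While (Less (Reg ''i'') (Reg ''u'')) double_step,
     Assign ''m'' (add (Reg ''u'') (Reg ''u''))]"

lemma double_correct:
  assumes u: "u = reg s ''u''" "u \<le> n" and w: "(n + 2)\<^sup>2 \<le> 2 ^ w"
  shows "wp w double (\<lambda>c s'. c \<le> 20 * n + 50 \<and>
    output_string s' = seg (arr s ''B'') 0 u @ seg (arr s ''B'') 0 u) s"
proof -
  have M: "n * n + 4 * n + 4 \<le> 2 ^ w" using w by (rule square_bound)
  then have "w \<noteq> 0" by (intro notI) simp
  let ?B = "arr s ''B''" and ?s0 = "s\<lparr>reg := (reg s)(''i'' := 0)\<rparr>"
  \<comment> \<open>Reads stay below \<open>u\<close> and writes start at \<open>u\<close>, so the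
    source is never overwritten.\<close>
  define I where "I s' \<longleftrightarrow> reg s' ''u'' = u \<and> reg s' ''i'' \<le> u \<and> (\<forall>j<u. arr s' ''B'' j = ?B j) \<and>
    (\<forall>j<reg s' ''i''. arr s' ''B'' (u + j) = ?B j)" for s' :: state
  have loop: "wp w (While (Less (Reg ''i'') (Reg ''u'')) double_step) (\<lambda>c s'. c \<le> 20 * n + 4 \<and> I s' \<and> reg s' ''i'' = u) ?s0"
  proof (rule wp_While[where K = 20 and \<Phi> = "\<lambda>s. u - reg s ''i''" and I = I])
    show "I ?s0" using u by (simp add: I_def)
  next
    fix s1 assume I: "I s1" and c: "cond_val w (Less (Reg ''i'') (Reg ''u'')) s1"
    then have "(u + reg s1 ''i'') mod 2 ^ w = u + reg s1 ''i''" "Suc (reg s1 ''i'') mod 2 ^ w = Suc (reg s1 ''i'')"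
      using u(2) M by (auto simp: I_def)
    then show "wp w double_step (\<lambda>c s'. I s' \<and> u - reg s' ''i'' < u - reg s1 ''i'' \<and>
        c + cond_cost (Less (Reg ''i'') (Reg ''u'')) + 1 \<le> 20) s1"
      using I c \<open>w \<noteq> 0\<close> by (auto simp: double_step_def I_def less_Suc_eq)
  qed (use u in \<open>auto simp: I_def\<close>)
  have out: "output_string (s'\<lparr>reg := (reg s')(''m'' := u + u)\<rparr>) = seg ?B 0 u @ seg ?B 0 u"
    if "I s'" "reg s' ''i'' = u" for s'
  proof -
    have "seg (arr s' ''B'') 0 u = seg ?B 0 u" using that by (intro seg_cong) (simp add: I_def)
    moreover have "seg (arr s' ''B'') u (u + u) = seg ?B 0 u"
      by (rule nth_equalityI) (use that in \<open>simp_all add: I_def seg_def\<close>)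
    ultimately show ?thesis
      using seg_split[of 0 u "u + u" "arr s' ''B''"] by (simp add: output_string_def seg_def)
  qed
  have uu: "(u + u) mod 2 ^ w = u + u" using u(2) M by simp
  show ?thesis
    unfolding double_def block.simps wp_Seq wp_Assign
    apply simp
    apply (rule wp_mono[OF loop])
    subgoal premises prems for c s'
      using prems out[of s'] uu by (auto simp: I_def)
    done
qed

text \<open>The letters from \<open>e\<close> on are pairwise distinct and new, so squares can be
  confined to the part before \<open>e\<close>.\<close>

lemma last_repeated_tail:
  assumes L: "last_repeated f n e" and Z: "subseq (Z @ Z) (seg f 0 n)"
  shows "subseq (Z @ Z) (seg f 0 e)"
proof (rule subseq_square_tail)
  have e: "e \<le> n" and fresh: "\<And>i j. i < j \<Longrightarrow> e \<le> j \<Longrightarrow> j < n \<Longrightarrow> f i \<noteq> f j"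
    using L cnt_less[of f] unfolding last_repeated_def by (blast, metis less_nat_zero_code)
  show "subseq (Z @ Z) (seg f 0 e @ seg f e n)" using Z seg_split[of 0 e n f] e by simp
  have "inj_on f {e..<n}"
    by (rule linorder_inj_onI) (use fresh in auto)
  then show "distinct (seg f e n)" by (simp add: seg_def distinct_map)
  show "set (seg f 0 e) \<inter> set (seg f e n) = {}"
    using fresh by (fastforce simp: set_seg)
qed

definition max_square :: com where
  "max_square = block [index, Ite (Less (Const 0) (Reg ''e'')) (block [prepare, stages]) Skip, double]"

lemma max_square_correct:
  assumes adm: "admissible 2 w S" and n: "n = length S"
  shows "wp w max_square (\<lambda>c s. c \<le> 6000 * (floorlog 2 n + 1) * (n + 1) \<and>
    maximal_square_subseq (output_string s) S) (input_state S)"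
proof -
  define f where "f = arr (input_state S) ''S''"
  have w: "(n + 2)\<^sup>2 \<le> 2 ^ w" using adm n by (simp add: admissible_def)
  have S: "seg f 0 n = S"
    by (rule nth_equalityI) (simp_all add: seg_def f_def input_state_def n)
  have T0: "index_tables f n 0 (arr (input_state S))"
    by (simp add: index_tables_def f_def input_state_def)
  have double: "wp w double (\<lambda>c s'. k + c \<le> 6000 * (floorlog 2 n + 1) * (n + 1) \<and>
      maximal_square_subseq (output_string s') S) s"
    if k: "k \<le> 300 * (floorlog 2 n + 1) * (17 * n + 10) + 80 * n + 350" and u: "reg s ''u'' \<le> n"
      and X: "X = seg (arr s ''B'') 0 (reg s ''u'')" "subseq (X @ X) (seg f 0 e)"
        "\<And>Z. subseq (Z @ Z) (seg f 0 e) \<Longrightarrow> subseq X Z \<Longrightarrow> Z = X"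
      and L: "last_repeated f n e" for k s X e
  proof (rule wp_mono[OF double_correct[OF refl u w]])
    fix c and s' :: state
    assume c: "c \<le> 20 * n + 50 \<and> output_string s' = seg (arr s ''B'') 0 (reg s ''u'') @ seg (arr s ''B'') 0 (reg s ''u'')"
    \<comment> \<open>The stages contribute \<open>5100 * n + 3000\<close> times the logarithmic
      factor, and the linear passes are absorbed by rounding up to 6000.\<close>
    have "300 * (floorlog 2 n + 1) * (17 * n + 10) + 100 * n + 400 \<le> 6000 * (floorlog 2 n + 1) * (n + 1)"
      by (simp add: algebra_simps)
    then have "k + c \<le> 6000 * (floorlog 2 n + 1) * (n + 1)" using k c by linarith
    moreover have "maximal_square_subseq (X @ X) S"
    proof (rule maximal_square_subseqI)
      have "e \<le> n" using L by (simp add: last_repeated_def)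
      then show "subseq (X @ X) S" using subseq_segI[OF X(2), of 0 n] S by simp
      show "Z = X" if "subseq (Z @ Z) S" "subseq X Z" for Z
        using last_repeated_tail[OF L, of Z] that X(3) S by simp
    qed
    ultimately show "k + c \<le> 6000 * (floorlog 2 n + 1) * (n + 1) \<and> maximal_square_subseq (output_string s') S"
      using c X(1) by simp
  qed
  have "wp w index (\<lambda>k. wp w (Ite (Less (Const 0) (Reg ''e'')) (block [prepare, stages]) Skip) (\<lambda>k'. wp w double
      (\<lambda>c s'. k + (k' + c) \<le> 6000 * (floorlog 2 n + 1) * (n + 1) \<and> maximal_square_subseq (output_string s') S))) (input_state S)"
  proof (rule wp_mono[OF index_correct[OF T0 _ _ _ _ w]])
    fix k and s :: state
    assume "k \<le> 60 * n + 4 \<and> static f n (reg s ''e'') (reg s ''f'') (reg s) (arr s) \<and>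
      last_repeated f n (reg s ''e'') \<and> reg s ''u'' = 0"
    moreover define e where "e = reg s ''e''"
    ultimately have k: "k \<le> 60 * n + 4" and st: "static f n e (reg s ''f'') (reg s) (arr s)"
      and L: "last_repeated f n e" and u: "reg s ''u'' = 0" by simp_all
    show "wp w (Ite (Less (Const 0) (Reg ''e'')) (block [prepare, stages]) Skip) (\<lambda>k'. wp w double
      (\<lambda>c s'. k + (k' + c) \<le> 6000 * (floorlog 2 n + 1) * (n + 1) \<and> maximal_square_subseq (output_string s') S)) s"
    proof (cases "e = 0")
      case True
      \<comment> \<open>No letter is repeated and \<open>u\<close> is still \<open>0\<close>, so the
        output is the empty string, then the only square.\<close>
      have "wp w double (\<lambda>c s'. (k + 5) + c \<le> 6000 * (floorlog 2 n + 1) * (n + 1) \<and>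
          maximal_square_subseq (output_string s') S) s"
        by (rule double[where X = "[]" and e = e]) (use k u L True in \<open>auto dest: list_emb_Nil2\<close>)
      then show ?thesis using True by (simp add: e_def)
    next
      case False
      have "e \<le> n" using L by (simp add: last_repeated_def)
      have "wp w prepare (\<lambda>k1. wp w stages (\<lambda>k2. wp w double
        (\<lambda>c s'. (k + (k1 + k2 + 4)) + c \<le> 6000 * (floorlog 2 n + 1) * (n + 1) \<and> maximal_square_subseq (output_string s') S))) s"
      proof (rule wp_mono[OF prepare_correct[OF st L _ w]])
        fix k1 and s1 :: state
        assume *: "k1 \<le> 20 * n + 100 \<and> (\<exists>m p p' r B. repeated_letter f (f (e - 1)) m p p' r (e - 1) \<and>
          (\<forall>i<m. B i = f (e - 1)) \<and> m \<le> n \<and> loop_inv f n e (Suc p') (Suc p) p' (Suc r) e m B [] s1)"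
        then obtain m p p' r B where rep: "repeated_letter f (f (e - 1)) m p p' r (e - 1)"
          and B: "\<forall>i<m. B i = f (e - 1)" "m \<le> n" and I: "loop_inv f n e (Suc p') (Suc p) p' (Suc r) e m B [] s1"
          by blast
        show "wp w stages (\<lambda>k2. wp w double (\<lambda>c s'. (k + (k1 + k2 + 4)) + c \<le> 6000 * (floorlog 2 n + 1) * (n + 1) \<and>
            maximal_square_subseq (output_string s') S)) s1"
          by (rule wp_mono[OF stages_correct[OF rep B I _ \<open>e \<le> n\<close> w]])
            (use False in simp, rule double[OF _ _ refl _ _ L], use * k in auto)
      qed (use False in simp)
      then show ?thesis using False by (simp add: e_def add.assoc)
    qed
  qed (simp_all add: input_state_def n)
  moreover have "wp w (Seq c1 c2) Q = wp w c1 (\<lambda>t1. wp w c2 (\<lambda>t2. Q (t1 + t2)))" for c1 c2 Q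
    by (rule ext) simp
  ultimately show ?thesis by (simp only: max_square_def block.simps)
qed

theorem theorem1:
  shows "\<exists>P T. computes_in_time P maximal_square_subseq T \<and>
           T \<in> O(\<lambda>n. real n * ln (real n))"
proof (intro exI conjI)
  let ?T = "\<lambda>n. real (6000 * (floorlog 2 n + 1) * (n + 1))"
  show "computes_in_time max_square maximal_square_subseq ?T"
    unfolding computes_in_time_def
  \<comment> \<open>Exponent 2 suffices because the largest addresses are those of
    \<open>OCC\<close>, below \<open>(n + 2)\<^sup>2\<close>.\<close>
  proof (rule exI[of _ 2], intro allI impI)
    fix w S assume "admissible 2 w S"
    from max_square_correct[OF this refl]
    show "\<exists>t s. exec w max_square (input_state S) t s \<and> real t \<le> ?T (length S) \<and>
        maximal_square_subseq (output_string s) S"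
      unfolding wp_def by (elim exE conjE, intro exI conjI) (assumption | simp only: of_nat_le_iff)+
  qed
  \<comment> \<open>For positive \<open>n\<close>, \<open>floorlog 2 n\<close> is the floor of the
    binary logarithm plus 1; with the \<open>+ 1\<close> in \<open>?T\<close> this gives the summand
    2.\<close>
  have "?T n \<le> 6000 * (ln (real n) / ln 2 + 2) * (real n + 1)" if "0 < n" for n
  proof -
    have "real (floorlog 2 n) \<le> log 2 (real n) + 1"
      using that by (simp add: floorlog_def)
    then have "6000 * (real (floorlog 2 n) + 1) * (real n + 1) \<le> 6000 * (ln (real n) / ln 2 + 2) * (real n + 1)"
      by (intro mult_right_mono mult_left_mono) (simp_all add: log_def)
    moreover have "?T n = 6000 * (real (floorlog 2 n) + 1) * (real n + 1)"
      by (simp only: of_nat_mult of_nat_add of_nat_1 of_nat_numeral)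
    ultimately show ?thesis by (simp only:)
  qed
  then have "?T \<in> O(\<lambda>n. 6000 * (ln (real n) / ln 2 + 2) * (real n + 1))"
    by (intro landau_o.big_mono eventually_mono[OF eventually_gt_at_top[of 0]]) (auto simp del: of_nat_mult)
  also have "(\<lambda>n. 6000 * (ln (real n) / ln 2 + 2) * (real n + 1)) \<in> O(\<lambda>n. real n * ln (real n))"
    by real_asymp
  finally show "?T \<in> O(\<lambda>n. real n * ln (real n))" .
qed

end
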